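(* Let $\mathbb{K}/\mathbb{F}$ be a totally ramified, tamely ramified, separable quadratic extension of non-archimedean local fields. Let $\mathcal{D}$ be a central division $\mathbb{F}$-algebra of even index $d$, let $\Delta$ be the centralizer of $\mathbb{K}$ in $\mathcal{D}$, and let $G=(\mathcal{D}\otimes_{\mathbb{F}}\mathbb{K})^{\times}\simeq \mathrm{GL}_2(\Delta)$. Let $(\pi,V)$ be a smooth irreducible complex representation of $G$ which belongs to the discrete series, has level $0$, and is not cuspidal. Then $$\dim_{\mathbb{C}}\big(\mathrm{Hom}_{\mathcal{D}^{\times}}(\pi,\mathbf{1})\big)\leq 1,$$ where $\mathbf{1}$ is the trivial character of $\mathcal{D}^{\times}$.
   Context: Index $d$ means $\dim_{\mathbb{F}}\mathcal{D}=d^2$. Since $d$ is even, $\mathbb{K}$ embeds in $\mathcal{D}$; fix such an embedding. The centralizer $\Delta$ is a central division $\mathbb{K}$-algebra of index $\delta=d/2$. View $\mathcal{D}$ as a right $\Delta$-vector space of dimension $2$; the map $x\otimes k\mapsto [y\mapsto xyk]$ is an isomorphism of $\mathbb{K}$-algebras $\mathcal{D}\otimes_{\mathbb{F}}\mathbb{K}\simeq \mathrm{End}_{\Delta}(\mathcal{D})\simeq \mathrm{M}_2(\Delta)$, and through it $\mathcal{D}^{\times}$ (acting by left multiplication) is a subgroup of $G$. All representations are complex and smooth. A representation of $G$ has level $0$ if it has a nonzero vector fixed by $1+\mathcal{P}$ where $\mathcal{P}$ is the Jacobson radical of some maximal order of $\mathrm{M}_2(\Delta)$ (i.e. by a conjugate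 of $1+\varpi_\Delta \mathrm{M}_2(\mathcal{O}_\Delta)$). *)

theory Defs
  imports
    "HOL-Analysis.Analysis"
    "HOL-Algebra.Coset"
    "HOL-Algebra.Subrings"
    "HOL-Library.Function_Algebras"
    "HOL-Computational_Algebra.Polynomial_Factorial"
begin

text \<open>
  Caution: \<open>Function_Algebras\<close> makes \<^term>\<open>(+)\<close> and \<^term>\<open>0\<close> available pointwise on functions, and
  this is how endomorphisms and linear forms are added below.  Its pointwise product and pointwise
  unit are never used: endomorphisms are multiplied by composition.
\<close>


section \<open>Non-archimedean local fields and their extensions\<close>

text \<open>A valuation is an integer-valued function whose value at \<open>0\<close> is irrelevant
  (it stands for infinity).\<close>

definition val_ball :: "('f::field \<Rightarrow> int) \<Rightarrow> int \<Rightarrow> 'f set" where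
  "val_ball v n = {x. x = 0 \<or> n \<le> v x}"

abbreviation val_ring :: "('f::field \<Rightarrow> int) \<Rightarrow> 'f set" where
  "val_ring v \<equiv> val_ball v 0"

abbreviation val_ideal :: "('f::field \<Rightarrow> int) \<Rightarrow> 'f set" where
  "val_ideal v \<equiv> val_ball v 1"

text \<open>A field that is complete for the normalized discrete valuation \<open>v\<close>, with finite residue field.\<close>

definition nonarch_local_field :: "('f::field \<Rightarrow> int) \<Rightarrow> bool" where
  "nonarch_local_field v \<longleftrightarrow>
     (\<forall>x y. x \<noteq> 0 \<longrightarrow> y \<noteq> 0 \<longrightarrow> v (x * y) = v x + v y) \<and>
     (\<forall>x y. x \<noteq> 0 \<longrightarrow> y \<noteq> 0 \<longrightarrow> x + y \<noteq> 0 \<longrightarrow> min (v x) (v y) \<le> v (x + y)) \<and>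
     (\<exists>x. x \<noteq> 0 \<and> v x = 1) \<and>
     (\<forall>X :: nat \<Rightarrow> 'f.
        (\<forall>n. \<exists>N. \<forall>m\<ge>N. \<forall>k\<ge>N. X m - X k \<in> val_ball v n) \<longrightarrow>
        (\<exists>l. \<forall>n. \<exists>N. \<forall>m\<ge>N. X m - l \<in> val_ball v n)) \<and>
     finite (val_ring v // {(x, y). x \<in> val_ring v \<and> y \<in> val_ring v \<and> x - y \<in> val_ideal v})"

definition ring_embedding :: "('a::ring_1 \<Rightarrow> 'b::ring_1) \<Rightarrow> bool" where
  "ring_embedding f \<longleftrightarrow>
     f 1 = 1 \<and> (\<forall>x y. f (x + y) = f x + f y) \<and> (\<forall>x y. f (x * y) = f x * f y) \<and> inj f"

definition dim_over :: "('f::field \<Rightarrow> 'a::ring_1) \<Rightarrow> nat" where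
  "dim_over i = vector_space.dim (\<lambda>a x. i a * x) (UNIV :: 'a set)"

text \<open>\<^term>\<open>dim_over i\<close> is \<open>0\<close> when the dimension is infinite, so the equations
  \<^prop>\<open>dim_over i = n\<close> below, all with positive \<open>n\<close>, include finite-dimensionality.\<close>

definition quadratic_extension :: "('f::field \<Rightarrow> 'k::field) \<Rightarrow> bool" where
  "quadratic_extension j \<longleftrightarrow> ring_embedding j \<and> dim_over j = 2"

definition separable_extension :: "('f::field \<Rightarrow> 'k::field) \<Rightarrow> bool" where
  "separable_extension j \<longleftrightarrow>
     (\<forall>x. \<exists>p. irreducible p \<and> coprime p (pderiv p) \<and> poly (map_poly j p) x = 0)"

definition has_ramification_index ::
  "('f::field \<Rightarrow> 'k::field) \<Rightarrow> ('f \<Rightarrow> int) \<Rightarrow> ('k \<Rightarrow> int) \<Rightarrow> nat \<Rightarrow> bool" where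
  "has_ramification_index j vF vK e \<longleftrightarrow> 0 < e \<and> (\<forall>a. a \<noteq> 0 \<longrightarrow> vK (j a) = int e * vF a)"

definition totally_ramified ::
  "('f::field \<Rightarrow> 'k::field) \<Rightarrow> ('f \<Rightarrow> int) \<Rightarrow> ('k \<Rightarrow> int) \<Rightarrow> bool" where
  "totally_ramified j vF vK \<longleftrightarrow> has_ramification_index j vF vK (dim_over j)"

text \<open>The prime \<open>p\<close> below is the residue characteristic.  The residue fields are finite, so separability
  of the residue extension is automatic.\<close>

definition tamely_ramified ::
  "('f::field \<Rightarrow> 'k::field) \<Rightarrow> ('f \<Rightarrow> int) \<Rightarrow> ('k \<Rightarrow> int) \<Rightarrow> bool" where
  "tamely_ramified j vF vK \<longleftrightarrow>
     (\<exists>e. has_ramification_index j vF vK e \<and>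
          (\<forall>p::nat. prime p \<and> of_nat p \<in> val_ideal vF \<longrightarrow> \<not> p dvd e))"


section \<open>The division algebra and the group\<close>

definition central_division_algebra :: "('f::field \<Rightarrow> 'd::division_ring) \<Rightarrow> nat \<Rightarrow> bool" where
  "central_division_algebra i d \<longleftrightarrow>
     ring_embedding i \<and> range i = {z. \<forall>x. z * x = x * z} \<and> 0 < d \<and> dim_over i = d ^ 2"

definition centralizer :: "'d::division_ring set \<Rightarrow> 'd set" where
  "centralizer S = {x. \<forall>s\<in>S. x * s = s * x}"

text \<open>The ring of endomorphisms of the right \<open>\<Delta>\<close>-vector space \<open>'d\<close>.\<close>

definition End_ring :: "'d::division_ring set \<Rightarrow> ('d \<Rightarrow> 'd) ring" where
  "End_ring \<Delta> =
     \<lparr> carrier = {f. (\<forall>x y. f (x + y) = f x + f y) \<and> (\<forall>x. \<forall>c\<in>\<Delta>. f (x * c) = f x * c)},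
       mult = (\<circ>), one = id, zero = 0, add = (+) \<rparr>"

text \<open>
  For an embedding \<open>\<iota> : K \<rightarrow> D\<close> of \<open>F\<close>-algebras and \<open>\<Delta>\<close> the centralizer of its image, the
  \<open>K\<close>-algebra \<open>D \<otimes>\<^sub>F K\<close> is identified with the endomorphism ring of \<open>D\<close> as a right
  \<open>\<Delta>\<close>-vector space, where \<open>x \<otimes> k\<close> acts by \<open>y \<mapsto> x y k\<close>.  So \<open>K\<close> acts on endomorphisms by
  \<^term>\<open>K_scale\<close>, and \<open>x \<in> D\<close> corresponds to \<^term>\<open>lmul x\<close>.
\<close>

definition DK_algebra :: "('k::field \<Rightarrow> 'd::division_ring) \<Rightarrow> ('d \<Rightarrow> 'd) ring" where
  "DK_algebra \<iota> = End_ring (centralizer (range \<iota>))"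

definition K_scale :: "('k::field \<Rightarrow> 'd::division_ring) \<Rightarrow> 'k \<Rightarrow> ('d \<Rightarrow> 'd) \<Rightarrow> ('d \<Rightarrow> 'd)" where
  "K_scale \<iota> k f = (\<lambda>y. f y * \<iota> k)"

definition lmul :: "'d::division_ring \<Rightarrow> 'd \<Rightarrow> 'd" where
  "lmul x = (\<lambda>y. x * y)"

definition DK_group :: "('k::field \<Rightarrow> 'd::division_ring) \<Rightarrow> ('d \<Rightarrow> 'd) monoid" where
  "DK_group \<iota> = units_of (DK_algebra \<iota>)"

definition D_units :: "('d::division_ring \<Rightarrow> 'd) set" where
  "D_units = lmul ` (UNIV - {0})"

text \<open>
  The canonical topology of a finite-dimensional vector space \<open>E\<close> over a valued field: the product
  topology of the coordinates in any basis of \<open>E\<close>.  Letting \<open>B\<close> run through all finite subsets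
  instead of one basis gives the same open sets and avoids a choice.
\<close>

definition vs_topology ::
  "('k::field \<Rightarrow> int) \<Rightarrow> ('k \<Rightarrow> 'e::ab_group_add \<Rightarrow> 'e) \<Rightarrow> 'e set \<Rightarrow> 'e topology" where
  "vs_topology v s E = topology (\<lambda>U. U \<subseteq> E \<and>
     (\<forall>x\<in>U. \<forall>B. finite B \<and> B \<subseteq> E \<longrightarrow>
        (\<exists>n. \<forall>c. (\<forall>b\<in>B. c b \<in> val_ball v n) \<longrightarrow> x + (\<Sum>b\<in>B. s (c b) b) \<in> U)))"

definition DK_topology ::
  "('k::field \<Rightarrow> int) \<Rightarrow> ('k \<Rightarrow> 'd::division_ring) \<Rightarrow> ('d \<Rightarrow> 'd) topology" where
  "DK_topology vK \<iota> =
     subtopology (vs_topology vK (K_scale \<iota>) (carrier (DK_algebra \<iota>))) (carrier (DK_group \<iota>))"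


section \<open>Maximal orders and Jacobson radicals\<close>

text \<open>An order in a finite-dimensional algebra \<open>A\<close> over a valued field: a subring with the same unit that
  spans \<open>A\<close> and is finitely generated as a module over the valuation ring.\<close>

definition is_order ::
  "('k::field \<Rightarrow> int) \<Rightarrow> ('k \<Rightarrow> 'e::ab_group_add \<Rightarrow> 'e) \<Rightarrow> 'e ring \<Rightarrow> 'e set \<Rightarrow> bool" where
  "is_order v s A R \<longleftrightarrow>
     subring R A \<and> module.span s R = carrier A \<and>
     (\<exists>B. finite B \<and> R = {\<Sum>b\<in>B. s (c b) b | c. \<forall>b\<in>B. c b \<in> val_ring v})"

definition is_maximal_order ::
  "('k::field \<Rightarrow> int) \<Rightarrow> ('k \<Rightarrow> 'e::ab_group_add \<Rightarrow> 'e) \<Rightarrow> 'e ring \<Rightarrow> 'e set \<Rightarrow> bool" where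
  "is_maximal_order v s A R \<longleftrightarrow>
     is_order v s A R \<and> (\<forall>R'. is_order v s A R' \<longrightarrow> R \<subseteq> R' \<longrightarrow> R' = R)"

definition left_ideal :: "'e set \<Rightarrow> ('e, 'm) ring_scheme \<Rightarrow> bool" where
  "left_ideal I R \<longleftrightarrow>
     additive_subgroup I R \<and> (\<forall>r\<in>carrier R. \<forall>x\<in>I. r \<otimes>\<^bsub>R\<^esub> x \<in> I)"

definition maximal_left_ideal :: "'e set \<Rightarrow> ('e, 'm) ring_scheme \<Rightarrow> bool" where
  "maximal_left_ideal I R \<longleftrightarrow>
     left_ideal I R \<and> I \<noteq> carrier R \<and>
     (\<forall>J. left_ideal J R \<longrightarrow> I \<subseteq> J \<longrightarrow> J = I \<or> J = carrier R)"

definition jacobson_radical :: "('e, 'm) ring_scheme \<Rightarrow> 'e set" where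
  "jacobson_radical R = carrier R \<inter> \<Inter>{I. maximal_left_ideal I R}"


section \<open>Smooth representations\<close>

text \<open>A representation of a topological group \<open>G\<close> (topology \<open>T\<close>) on the complex vector space \<open>'v\<close>
  with scalar multiplication \<open>sV\<close>.\<close>

definition smooth_representation ::
  "'g monoid \<Rightarrow> 'g topology \<Rightarrow> (complex \<Rightarrow> 'v::ab_group_add \<Rightarrow> 'v) \<Rightarrow> ('g \<Rightarrow> 'v \<Rightarrow> 'v) \<Rightarrow> bool" where
  "smooth_representation G T sV \<pi> \<longleftrightarrow>
     vector_space sV \<and>
     (\<forall>g\<in>carrier G. Vector_Spaces.linear sV sV (\<pi> g)) \<and>
     \<pi> \<one>\<^bsub>G\<^esub> = id \<and>
     (\<forall>g\<in>carrier G. \<forall>h\<in>carrier G. \<pi> (g \<otimes>\<^bsub>G\<^esub> h) = \<pi> g \<circ> \<pi> h) \<and>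
     (\<forall>x. openin T {g \<in> carrier G. \<pi> g x = x})"

definition irreducible_representation ::
  "'g monoid \<Rightarrow> (complex \<Rightarrow> 'v::ab_group_add \<Rightarrow> 'v) \<Rightarrow> ('g \<Rightarrow> 'v \<Rightarrow> 'v) \<Rightarrow> bool" where
  "irreducible_representation G sV \<pi> \<longleftrightarrow>
     (UNIV :: 'v set) \<noteq> {0} \<and>
     (\<forall>W. module.subspace sV W \<and> (\<forall>g\<in>carrier G. \<pi> g ` W \<subseteq> W) \<longrightarrow> W = {0} \<or> W = UNIV)"

definition smooth_dual ::
  "'g monoid \<Rightarrow> 'g topology \<Rightarrow> (complex \<Rightarrow> 'v::ab_group_add \<Rightarrow> 'v) \<Rightarrow> ('g \<Rightarrow> 'v \<Rightarrow> 'v)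
     \<Rightarrow> ('v \<Rightarrow> complex) set" where
  "smooth_dual G T sV \<pi> =
     {\<xi>. Vector_Spaces.linear sV (*) \<xi> \<and>
         (\<exists>H. subgroup H G \<and> openin T H \<and> (\<forall>h\<in>H. \<forall>x. \<xi> (\<pi> h x) = \<xi> x))}"

definition group_center :: "('g, 'm) monoid_scheme \<Rightarrow> 'g set" where
  "group_center G = {z \<in> carrier G. \<forall>g\<in>carrier G. z \<otimes>\<^bsub>G\<^esub> g = g \<otimes>\<^bsub>G\<^esub> z}"

definition coset_topology :: "('g, 'm) monoid_scheme \<Rightarrow> 'g topology \<Rightarrow> 'g set \<Rightarrow> 'g set topology" where
  "coset_topology G T N = topology (\<lambda>\<U>. \<U> \<subseteq> rcosets\<^bsub>G\<^esub> N \<and> openin T (\<Union>\<U>))"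

text \<open>A left Haar measure on the Borel sets of a locally compact group \<open>H\<close>.  It is only used for second
  countable groups, where its regularity is automatic.\<close>

definition haar_measure :: "('h, 'm) monoid_scheme \<Rightarrow> 'h topology \<Rightarrow> 'h measure \<Rightarrow> bool" where
  "haar_measure H T \<mu> \<longleftrightarrow>
     space \<mu> = carrier H \<and>
     sets \<mu> = sigma_sets (carrier H) {U. openin T U} \<and>
     (\<forall>g\<in>carrier H. \<forall>E\<in>sets \<mu>. emeasure \<mu> (g <#\<^bsub>H\<^esub> E) = emeasure \<mu> E) \<and>
     (\<forall>C\<in>sets \<mu>. compactin T C \<longrightarrow> emeasure \<mu> C < \<infinity>) \<and>
     (\<forall>U. openin T U \<and> U \<noteq> {} \<longrightarrow> 0 < emeasure \<mu> U)"

definition unitary_central_character ::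
  "'g monoid \<Rightarrow> (complex \<Rightarrow> 'v::ab_group_add \<Rightarrow> 'v) \<Rightarrow> ('g \<Rightarrow> 'v \<Rightarrow> 'v) \<Rightarrow> bool" where
  "unitary_central_character G sV \<pi> \<longleftrightarrow>
     (\<exists>\<omega>. \<forall>z\<in>group_center G. cmod (\<omega> z) = 1 \<and> (\<forall>x. \<pi> z x = sV (\<omega> z) x))"

text \<open>
  Unitary central character and matrix coefficients square-integrable modulo the center \<open>Z\<close>.  The
  absolute value of a coefficient is then constant on the cosets of \<open>Z\<close>, so its value at an arbitrary
  representative defines a function on \<open>G/Z\<close>.
\<close>

definition discrete_series ::
  "'g monoid \<Rightarrow> 'g topology \<Rightarrow> (complex \<Rightarrow> 'v::ab_group_add \<Rightarrow> 'v) \<Rightarrow> ('g \<Rightarrow> 'v \<Rightarrow> 'v) \<Rightarrow> bool" where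
  "discrete_series G T sV \<pi> \<longleftrightarrow>
     unitary_central_character G sV \<pi> \<and>
     (\<exists>\<mu>. haar_measure (G Mod group_center G) (coset_topology G T (group_center G)) \<mu> \<and>
        (\<forall>x. \<forall>\<xi>\<in>smooth_dual G T sV \<pi>.
           (\<integral>\<^sup>+ C. ennreal ((cmod (\<xi> (\<pi> (SOME g. g \<in> C) x)))\<^sup>2) \<partial>\<mu>) < \<infinity>))"

definition hom_to_trivial ::
  "'g set \<Rightarrow> (complex \<Rightarrow> 'v::ab_group_add \<Rightarrow> 'v) \<Rightarrow> ('g \<Rightarrow> 'v \<Rightarrow> 'v) \<Rightarrow> ('v \<Rightarrow> complex) set" where
  "hom_to_trivial H sV \<pi> =
     {l. Vector_Spaces.linear sV (*) l \<and> (\<forall>h\<in>H. \<forall>x. l (\<pi> h x) = l x)}"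

definition form_scale :: "complex \<Rightarrow> ('v \<Rightarrow> complex) \<Rightarrow> ('v \<Rightarrow> complex)" where
  "form_scale c l = (\<lambda>x. c * l x)"

text \<open>Finite-dimensionality must be said separately, since \<^const>\<open>vector_space.dim\<close> is \<open>0\<close> on
  infinite-dimensional spaces.\<close>

definition form_dim_le :: "('v \<Rightarrow> complex) set \<Rightarrow> nat \<Rightarrow> bool" where
  "form_dim_le S n \<longleftrightarrow>
     (\<exists>B. finite B \<and> S \<subseteq> module.span form_scale B) \<and> vector_space.dim form_scale S \<le> n"


section \<open>Level zero and cuspidality\<close>

definition level_zero ::
  "('k::field \<Rightarrow> int) \<Rightarrow> ('k \<Rightarrow> 'd::division_ring) \<Rightarrow> (('d \<Rightarrow> 'd) \<Rightarrow> 'v::ab_group_add \<Rightarrow> 'v) \<Rightarrow> bool" where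
  "level_zero vK \<iota> \<pi> \<longleftrightarrow>
     (\<exists>R. is_maximal_order vK (K_scale \<iota>) (DK_algebra \<iota>) R \<and>
        (\<exists>x. x \<noteq> 0 \<and>
           (\<forall>p\<in>jacobson_radical (DK_algebra \<iota>\<lparr>carrier := R\<rparr>).
              \<pi> (\<one>\<^bsub>DK_algebra \<iota>\<^esub> \<oplus>\<^bsub>DK_algebra \<iota>\<^esub> p) x = x)))"

text \<open>
  The proper parabolic subgroups of \<open>GL\<^sub>2(\<Delta>)\<close> are the stabilizers of the \<open>\<Delta>\<close>-lines \<open>L\<close> of the
  right \<open>\<Delta>\<close>-plane \<open>D\<close>.  The unipotent radical of the stabilizer of \<open>L\<close> consists of the elements that
  act trivially on \<open>L\<close> and on \<open>D/L\<close>.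
\<close>

definition is_line :: "'d::division_ring set \<Rightarrow> 'd set \<Rightarrow> bool" where
  "is_line \<Delta> L \<longleftrightarrow> (\<exists>y. y \<noteq> 0 \<and> L = {y * c | c. c \<in> \<Delta>})"

definition unipotent_radical :: "('k::field \<Rightarrow> 'd::division_ring) \<Rightarrow> 'd set \<Rightarrow> ('d \<Rightarrow> 'd) set" where
  "unipotent_radical \<iota> L =
     {g \<in> carrier (DK_group \<iota>). (\<forall>y\<in>L. g y = y) \<and> (\<forall>y. g y - y \<in> L)}"

text \<open>The Jacquet module for a unipotent radical \<open>N\<close> is \<open>V/V(N)\<close>, with \<open>V(N)\<close> the following space.\<close>

definition jacquet_kernel ::
  "'g set \<Rightarrow> (complex \<Rightarrow> 'v::ab_group_add \<Rightarrow> 'v) \<Rightarrow> ('g \<Rightarrow> 'v \<Rightarrow> 'v) \<Rightarrow> 'v set" where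
  "jacquet_kernel N sV \<pi> = module.span sV {\<pi> n x - x | n x. n \<in> N}"

text \<open>All Jacquet modules for proper parabolic subgroups vanish.\<close>

definition cuspidal ::
  "('k::field \<Rightarrow> 'd::division_ring) \<Rightarrow> (complex \<Rightarrow> 'v::ab_group_add \<Rightarrow> 'v)
     \<Rightarrow> (('d \<Rightarrow> 'd) \<Rightarrow> 'v \<Rightarrow> 'v) \<Rightarrow> bool" where
  "cuspidal \<iota> sV \<pi> \<longleftrightarrow>
     (\<forall>L. is_line (centralizer (range \<iota>)) L \<longrightarrow> jacquet_kernel (unipotent_radical \<iota> L) sV \<pi> = UNIV)"


section \<open>Sanity checks\<close>

lemma val_ball_mono: "m \<le> n \<Longrightarrow> val_ball v n \<subseteq> val_ball v m"
  by (auto simp: val_ball_def)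

lemma openin_vs_topology:
  fixes E :: "'e::ab_group_add set"
  shows "openin (vs_topology v s E) U \<longleftrightarrow> U \<subseteq> E \<and>
     (\<forall>x\<in>U. \<forall>B. finite B \<and> B \<subseteq> E \<longrightarrow>
        (\<exists>n. \<forall>c. (\<forall>b\<in>B. c b \<in> val_ball v n) \<longrightarrow> x + (\<Sum>b\<in>B. s (c b) b) \<in> U))"
proof -
  let ?P = "\<lambda>U x B n. \<forall>c. (\<forall>b\<in>B. c b \<in> val_ball v n) \<longrightarrow> x + (\<Sum>b\<in>B. s (c b) b) \<in> U"
  have mono: "?P U' x B n'" if "?P U x B n" "n \<le> n'" "U \<subseteq> U'" for U U' x B n n'
    using that val_ball_mono[OF that(2), of v] by blast
  have "istopology (\<lambda>U. U \<subseteq> E \<and> (\<forall>x\<in>U. \<forall>B. finite B \<and> B \<subseteq> E \<longrightarrow> (\<exists>n. ?P U x B n)))"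
    unfolding istopology_def
  proof (intro conjI allI impI ballI)
    fix S U x B
    assume S: "S \<subseteq> E \<and> (\<forall>x\<in>S. \<forall>B. finite B \<and> B \<subseteq> E \<longrightarrow> (\<exists>n. ?P S x B n))"
      and U: "U \<subseteq> E \<and> (\<forall>x\<in>U. \<forall>B. finite B \<and> B \<subseteq> E \<longrightarrow> (\<exists>n. ?P U x B n))"
    show "S \<inter> U \<subseteq> E" using S by blast
    assume x: "x \<in> S \<inter> U" and B: "finite B \<and> B \<subseteq> E"
    obtain m where m: "?P S x B m" using S x B by blast
    obtain n where n: "?P U x B n" using U x B by blast
    have "?P S x B (max m n)" by (rule mono[OF m]) auto
    moreover have "?P U x B (max m n)" by (rule mono[OF n]) auto
    ultimately show "\<exists>n. ?P (S \<inter> U) x B n" by blast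
  next
    fix \<K> :: "'e set set" and x B
    assume K: "\<forall>U\<in>\<K>. U \<subseteq> E \<and> (\<forall>x\<in>U. \<forall>B. finite B \<and> B \<subseteq> E \<longrightarrow> (\<exists>n. ?P U x B n))"
    show "\<Union>\<K> \<subseteq> E" using K by blast
    assume x: "x \<in> \<Union>\<K>" and B: "finite B \<and> B \<subseteq> E"
    from x obtain U where U: "U \<in> \<K>" "x \<in> U" by (rule UnionE)
    have "\<forall>x\<in>U. \<forall>B. finite B \<and> B \<subseteq> E \<longrightarrow> (\<exists>n. ?P U x B n)"
      using bspec[OF K U(1)] by (rule conjunct2)
    from bspec[OF this U(2)] have "finite B \<and> B \<subseteq> E \<longrightarrow> (\<exists>n. ?P U x B n)" by (rule spec)
    then have "\<exists>n. ?P U x B n" using B by (rule mp)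
    then obtain n where n: "?P U x B n" ..
    have "?P (\<Union>\<K>) x B n" by (rule mono[OF n order_refl Union_upper[OF U(1)]])
    then show "\<exists>n. ?P (\<Union>\<K>) x B n" ..
  qed
  then show ?thesis
    unfolding vs_topology_def by (simp add: topology_inverse')
qed

lemma (in group) openin_coset_topology:
  assumes "subgroup N G"
  shows "openin (coset_topology G T N) \<U> \<longleftrightarrow> \<U> \<subseteq> rcosets N \<and> openin T (\<Union>\<U>)"
proof -
  have "istopology (\<lambda>\<U>. \<U> \<subseteq> rcosets N \<and> openin T (\<Union>\<U>))"
    unfolding istopology_def
  proof (intro conjI allI impI)
    fix S U
    assume S: "S \<subseteq> rcosets N \<and> openin T (\<Union>S)" and U: "U \<subseteq> rcosets N \<and> openin T (\<Union>U)"
    show "S \<inter> U \<subseteq> rcosets N" using S by blast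
    have "\<Union>S \<inter> \<Union>U \<subseteq> \<Union>(S \<inter> U)"
    proof
      fix x assume "x \<in> \<Union>S \<inter> \<Union>U"
      then obtain A B where AB: "A \<in> S" "B \<in> U" "x \<in> A" "x \<in> B" by blast
      then have "A = B"
        using rcos_disjoint[OF assms] S U unfolding pairwise_def disjnt_def by blast
      then show "x \<in> \<Union>(S \<inter> U)" using AB by blast
    qed
    then have "\<Union>(S \<inter> U) = \<Union>S \<inter> \<Union>U" by blast
    then show "openin T (\<Union>(S \<inter> U))" using S U by auto
  next
    fix \<K> :: "'a set set set"
    assume K: "\<forall>U\<in>\<K>. U \<subseteq> rcosets N \<and> openin T (\<Union>U)"
    show "\<Union>\<K> \<subseteq> rcosets N" using K by blast
    have "\<Union>(\<Union>\<K>) = \<Union>(Union ` \<K>)" by blast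
    then show "openin T (\<Union>(\<Union>\<K>))" using K by auto
  qed
  then show ?thesis
    unfolding coset_topology_def by (simp add: topology_inverse')
qed

lemma (in group) group_center_normal: "group_center G \<lhd> G"
proof -
  have sub: "subgroup (group_center G) G"
  proof
    show "group_center G \<subseteq> carrier G" by (auto simp: group_center_def)
    show "\<one> \<in> group_center G" by (auto simp: group_center_def)
  next
    fix x y assume xy: "x \<in> group_center G" "y \<in> group_center G"
    then have c: "x \<in> carrier G" "y \<in> carrier G"
      "\<And>g. g \<in> carrier G \<Longrightarrow> x \<otimes> g = g \<otimes> x" "\<And>g. g \<in> carrier G \<Longrightarrow> y \<otimes> g = g \<otimes> y"
      by (auto simp: group_center_def)
    show "x \<otimes> y \<in> group_center G"
      unfolding group_center_def
    proof (intro CollectI conjI ballI)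
      show "x \<otimes> y \<in> carrier G" using c(1,2) by simp
      fix g assume g: "g \<in> carrier G"
      have "x \<otimes> y \<otimes> g = x \<otimes> (g \<otimes> y)"
        using c(1,2) g by (simp add: m_assoc c(4)[OF g])
      also have "\<dots> = g \<otimes> (x \<otimes> y)"
        using c(1,2) g by (simp add: m_assoc[symmetric] c(3)[OF g])
      finally show "x \<otimes> y \<otimes> g = g \<otimes> (x \<otimes> y)" .
    qed
  next
    fix x assume "x \<in> group_center G"
    then have c: "x \<in> carrier G" "\<And>g. g \<in> carrier G \<Longrightarrow> x \<otimes> g = g \<otimes> x"
      by (auto simp: group_center_def)
    show "inv x \<in> group_center G"
      unfolding group_center_def
    proof (intro CollectI conjI ballI)
      show "inv x \<in> carrier G" using c(1) by simp
      fix g assume g: "g \<in> carrier G"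
      have "inv x \<otimes> g = inv x \<otimes> (g \<otimes> x) \<otimes> inv x"
        using c(1) g by (simp add: m_assoc)
      also have "\<dots> = inv x \<otimes> (x \<otimes> g) \<otimes> inv x" by (simp add: c(2)[OF g])
      also have "\<dots> = g \<otimes> inv x" using c(1) g by (simp add: m_assoc[symmetric])
      finally show "inv x \<otimes> g = g \<otimes> inv x" .
    qed
  qed
  have "g \<otimes> h \<otimes> inv g \<in> group_center G" if "g \<in> carrier G" "h \<in> group_center G" for g h
  proof -
    have "g \<otimes> h \<otimes> inv g = h \<otimes> g \<otimes> inv g" and h: "h \<in> carrier G"
      using that by (auto simp: group_center_def)
    then have "g \<otimes> h \<otimes> inv g = h" using that(1) by (simp add: m_assoc)
    then show ?thesis using that(2) by simp
  qed
  then show ?thesis using sub by (simp add: normal_inv_iff)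
qed

lemma ring_End_ring: "ring (End_ring \<Delta>)"
proof (rule ringI)
  show "abelian_group (End_ring \<Delta>)"
  proof (rule abelian_groupI)
    fix f assume f: "f \<in> carrier (End_ring \<Delta>)"
    show "\<exists>g\<in>carrier (End_ring \<Delta>). g \<oplus>\<^bsub>End_ring \<Delta>\<^esub> f = \<zero>\<^bsub>End_ring \<Delta>\<^esub>"
      by (rule bexI[of _ "- f"]) (use f in \<open>auto simp: End_ring_def\<close>)
  qed (auto simp: End_ring_def algebra_simps)
  show "Group.monoid (End_ring \<Delta>)"
    by (rule monoidI) (auto simp: End_ring_def)
qed (auto simp: End_ring_def)

lemma group_DK_group: "group (DK_group \<iota>)"
  unfolding DK_group_def DK_algebra_def
  by (intro Group.monoid.units_group ring.is_monoid ring_End_ring)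

lemma D_units_subgroup: "subgroup D_units (DK_group (\<iota> :: 'k::field \<Rightarrow> 'd::division_ring))"
proof -
  interpret group "DK_group \<iota>" by (rule group_DK_group)
  have car: "lmul x \<in> carrier (DK_algebra \<iota>)" for x
    by (simp add: DK_algebra_def End_ring_def lmul_def algebra_simps)
  have mul: "lmul x \<otimes>\<^bsub>DK_group \<iota>\<^esub> lmul y = lmul (x * y)" for x y
    by (auto simp: DK_group_def DK_algebra_def units_of_def End_ring_def lmul_def mult.assoc)
  have one: "\<one>\<^bsub>DK_group \<iota>\<^esub> = lmul 1"
    by (auto simp: DK_group_def DK_algebra_def units_of_def End_ring_def lmul_def)
  have unit: "lmul x \<in> carrier (DK_group \<iota>)" if "x \<noteq> 0" for x
  proof -
    have "lmul (inverse x) \<otimes>\<^bsub>DK_algebra \<iota>\<^esub> lmul x = \<one>\<^bsub>DK_algebra \<iota>\<^esub>"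
         "lmul x \<otimes>\<^bsub>DK_algebra \<iota>\<^esub> lmul (inverse x) = \<one>\<^bsub>DK_algebra \<iota>\<^esub>"
      using mul[of "inverse x" x] mul[of x "inverse x"] one that
      by (simp_all add: DK_group_def units_of_def)
    then show ?thesis
      using car unfolding DK_group_def units_of_def Units_def by auto
  qed
  show ?thesis
  proof (rule subgroupI)
    show "D_units \<subseteq> carrier (DK_group \<iota>)" using unit by (auto simp: D_units_def)
    have "lmul 1 \<in> (D_units :: ('d \<Rightarrow> 'd) set)" by (simp add: D_units_def)
    then show "(D_units :: ('d \<Rightarrow> 'd) set) \<noteq> {}" by blast
  next
    fix a :: "'d \<Rightarrow> 'd" assume "a \<in> D_units"
    then obtain x where x: "a = lmul x" "x \<noteq> 0" by (auto simp: D_units_def)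
    have "inv\<^bsub>DK_group \<iota>\<^esub> a = lmul (inverse x)"
      by (rule inv_equality) (use x unit mul one in auto)
    then show "inv\<^bsub>DK_group \<iota>\<^esub> a \<in> D_units" using x by (auto simp: D_units_def)
  next
    fix a b :: "'d \<Rightarrow> 'd" assume "a \<in> D_units" "b \<in> D_units"
    then show "a \<otimes>\<^bsub>DK_group \<iota>\<^esub> b \<in> D_units" by (auto simp: D_units_def mul)
  qed
qed

lemma vector_space_form_scale: "vector_space form_scale"
  unfolding vector_space_def form_scale_def by (auto simp: fun_eq_iff distrib_left distrib_right)

lemma vector_space_K_scale:
  assumes "ring_embedding \<iota>"
  shows "vector_space (K_scale \<iota>)"
proof -
  have mul: "\<iota> (a * b) = \<iota> b * \<iota> a" for a b
    using assms unfolding ring_embedding_def by (metis mult.commute)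
  show ?thesis
    using assms unfolding vector_space_def K_scale_def ring_embedding_def
    by (auto simp: fun_eq_iff distrib_left distrib_right mul mult.assoc)
qed

lemma vector_space_embedding: "ring_embedding i \<Longrightarrow> vector_space (\<lambda>a x. i a * x)"
  unfolding vector_space_def ring_embedding_def by (auto simp: distrib_left distrib_right mult.assoc)

end

theory Submission
  imports Defs "HOL-Computational_Algebra.Fundamental_Theorem_Algebra"
begin

text \<open>
  Let \<open>\<kappa>\<close> be a square root generating \<open>K\<close> over \<open>F\<close> and let \<open>w \<in> D\<^sup>\<times>\<close> anticommute with it, so that
  \<open>D = \<Delta> \<oplus> w \<Delta>\<close>.  As \<open>D\<^sup>\<times>\<close> permutes the \<open>\<Delta>\<close>-lines of \<open>D\<close> transitively, \<open>G = N diag(1, \<Delta>\<^sup>\<times>) D\<^sup>\<times>\<close>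
  for the unipotent radical \<open>N\<close> of the stabilizer of \<open>\<Delta>\<close>, and \<open>V(N) \<noteq> V\<close>.  If there is a nonzero
  \<open>D\<^sup>\<times>\<close>-invariant form, then \<open>F\<^sup>\<times>\<close> acts trivially; hence \<open>D\<^sup>\<times>\<close> has finite orbits, and averaging over
  them shows that invariant forms are determined by their values on \<open>V\<^bsup>D\<^sup>\<times>\<^esup>\<close>.

  It remains to see that \<open>V\<^bsup>D\<^sup>\<times>\<^esup>\<close> is at most a line.  By irreducibility no proper subspace that contains
  \<open>V(N)\<close> and is stable under \<open>diag(1, \<Delta>\<^sup>\<times>)\<close> contains a nonzero \<open>D\<^sup>\<times>\<close>-fixed vector \<open>v\<close>; so \<open>v\<close> generates
  \<open>V/V(N)\<close> over \<open>\<Delta>\<^sup>\<times>\<close>.  Another fixed vector is \<open>v' = T v\<close> modulo \<open>V(N)\<close> with \<open>T\<close> in the group algebra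
  of \<open>\<Delta>\<^sup>\<times>\<close>.  Both vectors are invariant under the diagonally embedded \<open>\<Delta>\<^sup>\<times>\<close>, which acts on \<open>T\<close> by
  conjugation, so \<open>T\<close> can be averaged to a central element (the argument that \<open>(\<Gamma> \<times> \<Gamma>, \<Gamma>)\<close> is a
  Gelfand pair).  With \<open>z = diag(1, \<varpi>\<^sub>F)\<close>, the module \<open>V/V(N)\<close> is finitely generated over
  \<open>\<complex>[z + z\<^sup>-\<^sup>1]\<close>, so some quotient by \<open>z + z\<^sup>-\<^sup>1 - \<mu>\<close> is nonzero and of finite dimension.  There
  some \<open>T - c\<close> is not surjective, and the preimage of its image is a proper subspace as above that
  contains \<open>v' - c v\<close>.
\<close>

section \<open>Eigenvalues on finitely generated quotients\<close>

locale complex_endomorphism = V: vector_space sV + T: Vector_Spaces.linear sV sV T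
  for sV :: "complex \<Rightarrow> 'v::ab_group_add \<Rightarrow> 'v" and T :: "'v \<Rightarrow> 'v"
begin

text \<open>The operator \<open>p(T)\<close>, evaluated by Horner's scheme; it makes V a module over
  the complex polynomials.\<close>

definition poly_op :: "complex poly \<Rightarrow> 'v \<Rightarrow> 'v" where
  "poly_op p = fold_coeffs (\<lambda>a g x. sV a x + T (g x)) p (\<lambda>_. 0)"

lemma poly_op_0 [simp]: "poly_op 0 x = 0"
  by (simp add: poly_op_def)

lemma poly_op_pCons [simp]: "poly_op (pCons a p) x = sV a x + T (poly_op p x)"
  by (cases "p = 0 \<and> a = 0") (auto simp: poly_op_def T.zero)

lemma poly_op_1 [simp]: "poly_op 1 x = x"
  by (simp add: one_pCons T.zero)

lemma poly_op_add: "poly_op (p + q) x = poly_op p x + poly_op q x"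
  by (induction p q rule: poly_induct2) (simp_all add: T.add V.scale_left_distrib)

lemma poly_op_smult: "poly_op (Polynomial.smult c p) x = sV c (poly_op p x)"
  by (induction p) (simp_all add: T.scale V.scale_right_distrib)

lemma poly_op_diff: "poly_op (p - q) x = poly_op p x - poly_op q x"
proof -
  have "p - q = p + Polynomial.smult (-1) q" by simp
  then show ?thesis by (simp only: poly_op_add poly_op_smult) simp
qed

lemma poly_op_mult: "poly_op (p * q) x = poly_op p (poly_op q x)"
  by (induction p) (simp_all add: poly_op_add poly_op_smult T.zero)

lemma poly_op_mem:
  assumes "V.subspace U" "\<And>x. x \<in> U \<Longrightarrow> T x \<in> U" "x \<in> U"
  shows "poly_op p x \<in> U"
  by (induction p) (use assms in \<open>auto intro: V.subspace_add V.subspace_scale simp: V.subspace_0\<close>)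

text \<open>This is U + (T - \<mu>) V. For a T-stable U it is the preimage in V of the image of T -
  \<mu> on V/U, so it is proper exactly when T - \<mu> is not surjective on V/U.\<close>

definition shift_image :: "'v set \<Rightarrow> complex \<Rightarrow> 'v set" where
  "shift_image U \<mu> = {u + (T x - sV \<mu> x) | u x. u \<in> U}"

lemma subspace_shift_image:
  assumes "V.subspace U"
  shows "V.subspace (shift_image U \<mu>)"
proof (rule V.subspaceI)
  show "0 \<in> shift_image U \<mu>"
    unfolding shift_image_def using V.subspace_0[OF assms] T.zero
    by (auto intro!: exI[of _ 0])
next
  fix x y assume "x \<in> shift_image U \<mu>" "y \<in> shift_image U \<mu>"
  then obtain u u' z z' where "u \<in> U" "u' \<in> U" "x = u + (T z - sV \<mu> z)" "y = u' + (T z' - sV \<mu> z')"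
    unfolding shift_image_def by blast
  then have "u + u' \<in> U" "x + y = (u + u') + (T (z + z') - sV \<mu> (z + z'))"
    using V.subspace_add[OF assms] by (simp_all add: T.add V.scale_right_distrib)
  then show "x + y \<in> shift_image U \<mu>"
    unfolding shift_image_def by blast
next
  fix c x assume "x \<in> shift_image U \<mu>"
  then obtain u z where "u \<in> U" "x = u + (T z - sV \<mu> z)"
    unfolding shift_image_def by blast
  then have "sV c u \<in> U" "sV c x = sV c u + (T (sV c z) - sV \<mu> (sV c z))"
    using V.subspace_scale[OF assms]
    by (simp_all add: T.scale V.scale_right_distrib V.scale_right_diff_distrib mult.commute)
  then show "sV c x \<in> shift_image U \<mu>"
    unfolding shift_image_def by blast
qed

lemma subset_shift_image: "U \<subseteq> shift_image U \<mu>"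
  unfolding shift_image_def by (force intro: exI[of _ 0] simp: T.zero)

lemma shift_in_shift_image: "V.subspace U \<Longrightarrow> T x - sV \<mu> x \<in> shift_image U \<mu>"
  unfolding shift_image_def using V.subspace_0 by force

lemma shift_image_mono: "U \<subseteq> U' \<Longrightarrow> shift_image U \<mu> \<subseteq> shift_image U' \<mu>"
  unfolding shift_image_def by blast

text \<open>Modulo U the space is a nonzero cyclic module over the polynomials in T. If no nonzero
  polynomial annihilates v, the module is free and T itself is not surjective; otherwise any root
  \<mu> of an annihilator of least degree works.\<close>

lemma proper_shift_cyclic:
  assumes U: "V.subspace U" "\<And>x. x \<in> U \<Longrightarrow> T x \<in> U" and "U \<noteq> UNIV"
    and gen: "\<And>W. V.subspace W \<Longrightarrow> U \<subseteq> W \<Longrightarrow> v \<in> W \<Longrightarrow> (\<And>x. x \<in> W \<Longrightarrow> T x \<in> W) \<Longrightarrow> W = UNIV"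
  shows "\<exists>\<mu>. shift_image U \<mu> \<noteq> UNIV"
proof -
  have "v \<notin> U" using gen[OF U(1)] U(2) \<open>U \<noteq> UNIV\<close> by blast
  define W where "W = {u + poly_op s v | u s. u \<in> U}"
  have W: "W = UNIV"
  proof (rule gen)
    show "V.subspace W"
    proof (rule V.subspaceI)
      show "0 \<in> W" unfolding W_def using V.subspace_0[OF U(1)] by (auto intro!: exI[of _ 0])
    next
      fix x y assume "x \<in> W" "y \<in> W"
      then obtain u u' s s' where "u \<in> U" "u' \<in> U" "x = u + poly_op s v" "y = u' + poly_op s' v"
        unfolding W_def by blast
      then show "x + y \<in> W" unfolding W_def using V.subspace_add[OF U(1)]
        by (auto intro!: exI[of _ "u + u'"] exI[of _ "s + s'"] simp: poly_op_add algebra_simps)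
    next
      fix c x assume "x \<in> W"
      then obtain u s where "u \<in> U" "x = u + poly_op s v"
        unfolding W_def by blast
      then show "sV c x \<in> W" unfolding W_def using V.subspace_scale[OF U(1)]
        by (auto intro!: exI[of _ "sV c u"] exI[of _ "Polynomial.smult c s"] simp: poly_op_smult V.scale_right_distrib)
    qed
    show "U \<subseteq> W" unfolding W_def by (force intro: exI[of _ 0])
    show "v \<in> W" unfolding W_def using V.subspace_0[OF U(1)]
      by (auto intro!: exI[of _ 0] exI[of _ 1])
    show "T x \<in> W" if x: "x \<in> W" for x
    proof -
      obtain u s where "u \<in> U" "x = u + poly_op s v"
        using x unfolding W_def by blast
      then show ?thesis unfolding W_def using U(2)
        by (auto intro!: exI[of _ "T u"] exI[of _ "pCons 0 s"] simp: T.add)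
    qed
  qed
  \<comment> \<open>Surjectivity of T - \<mu> on V/U puts v in the image. By \<open>W\<close> a
    preimage is \<open>s(T) v\<close> modulo U, so 1 - (X - \<mu>) s annihilates v modulo U.\<close>
  have solve: "\<exists>s. poly_op (1 - [:- \<mu>, 1:] * s) v \<in> U" if surj: "shift_image U \<mu> = UNIV" for \<mu>
  proof -
    have "v \<in> shift_image U \<mu>" using surj by blast
    then obtain u x where u: "u \<in> U" "v = u + (T x - sV \<mu> x)"
      unfolding shift_image_def by blast
    obtain u' s where u': "u' \<in> U" "x = u' + poly_op s v" using W unfolding W_def by blast
    have "poly_op (1 - [:- \<mu>, 1:] * s) v = v - (T (poly_op s v) - sV \<mu> (poly_op s v))"
      by (simp add: poly_op_diff poly_op_mult poly_op_smult poly_op_add T.zero del: mult_pCons_left)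
    also have "\<dots> = u + (T u' - sV \<mu> u')"
    proof -
      have "T x - sV \<mu> x = (T u' - sV \<mu> u') + (T (poly_op s v) - sV \<mu> (poly_op s v))"
        by (simp add: u'(2) T.add V.scale_right_distrib)
      with u(2) have "v = u + (T u' - sV \<mu> u') + (T (poly_op s v) - sV \<mu> (poly_op s v))"
        by (simp only: add.assoc)
      then show ?thesis by (metis add_diff_cancel_right')
    qed
    also have "\<dots> \<in> U" using u u' U(2) by (intro V.subspace_add V.subspace_diff V.subspace_scale U(1)) auto
    finally show ?thesis by blast
  qed
  show ?thesis
  proof (cases "\<exists>p. p \<noteq> 0 \<and> poly_op p v \<in> U")
    case False
    \<comment> \<open>With trivial annihilator, 1 - X s would be the zero polynomial, but its value
      at 0 is 1.\<close>
    have "shift_image U 0 \<noteq> UNIV"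
    proof
      assume "shift_image U 0 = UNIV"
      then obtain s where "poly_op (1 - [:- 0, 1:] * s) v \<in> U" using solve by blast
      with False have "1 - [:- 0, 1:] * s = 0" by blast
      then have "poly (1 - [:- 0, 1:] * s) 0 = 0" by (simp only: poly_0)
      then show False by simp
    qed
    then show ?thesis by blast
  next
    case True
    then obtain p where p: "p \<noteq> 0" "poly_op p v \<in> U"
      and min: "\<And>q. degree q < degree p \<Longrightarrow> q = 0 \<or> poly_op q v \<notin> U"
      using ex_has_least_nat[of "\<lambda>p. p \<noteq> 0 \<and> poly_op p v \<in> U" _ degree] by (meson linorder_not_less)
    have "degree p \<noteq> 0"
    proof
      assume "degree p = 0"
      then obtain c where c: "p = [:c:]" by (meson degree_eq_zeroE)
      then have "sV c v \<in> U" "c \<noteq> 0" using p by (auto simp: T.zero)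
      then have "sV (inverse c) (sV c v) \<in> U" using U(1) by (blast intro: V.subspace_scale)
      then show False using \<open>c \<noteq> 0\<close> \<open>v \<notin> U\<close> by simp
    qed
    then obtain \<mu> where "poly p \<mu> = 0"
      using fundamental_theorem_of_algebra[of p] constant_degree[of p] by auto
    then obtain q where q: "p = [:- \<mu>, 1:] * q" by (meson poly_eq_0_iff_dvd dvdE)
    have "q \<noteq> 0" using p(1) q by auto
    then have "degree p = Suc (degree q)" unfolding q by (subst degree_mult_eq) auto
    then have qU: "poly_op q v \<notin> U" using min[of q] \<open>q \<noteq> 0\<close> by auto
    have "shift_image U \<mu> \<noteq> UNIV"
    proof
      assume "shift_image U \<mu> = UNIV"
      then obtain s where s: "poly_op (1 - [:- \<mu>, 1:] * s) v \<in> U" using solve by blast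
      \<comment> \<open>A Bezout combination of two annihilators of v; it makes q an annihilator of
        smaller degree than p.\<close>
      have "q = q * (1 - [:- \<mu>, 1:] * s) + s * p" unfolding q by (simp add: algebra_simps)
      then have "poly_op q v = poly_op q (poly_op (1 - [:- \<mu>, 1:] * s) v) + poly_op s (poly_op p v)"
        by (metis poly_op_add poly_op_mult)
      also have "\<dots> \<in> U" by (intro V.subspace_add poly_op_mem U s p)
      finally show False using qU by simp
    qed
    then show ?thesis by blast
  qed
qed

lemma proper_shift:
  assumes "finite S" and U: "V.subspace U" "\<And>x. x \<in> U \<Longrightarrow> T x \<in> U" and "U \<noteq> UNIV"
    and gen: "\<And>W. V.subspace W \<Longrightarrow> U \<subseteq> W \<Longrightarrow> S \<subseteq> W \<Longrightarrow> (\<And>x. x \<in> W \<Longrightarrow> T x \<in> W) \<Longrightarrow> W = UNIV"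
  shows "\<exists>\<mu>. shift_image U \<mu> \<noteq> UNIV"
  using assms
proof (induction S rule: finite_induct)
  case empty
  then show ?case by blast
next
  case (insert v S)
  define U' where "U' = \<Inter>{W. V.subspace W \<and> U \<subseteq> W \<and> S \<subseteq> W \<and> (\<forall>x\<in>W. T x \<in> W)}"
  have U': "V.subspace U'" "\<And>x. x \<in> U' \<Longrightarrow> T x \<in> U'" "U \<subseteq> U'" "S \<subseteq> U'"
    unfolding U'_def by (auto intro!: V.subspace_Inter)
  show ?case
  proof (cases "U' = UNIV")
    case True
    have "W = UNIV" if "V.subspace W" "U \<subseteq> W" "S \<subseteq> W" "\<And>x. x \<in> W \<Longrightarrow> T x \<in> W" for W
    proof -
      have "U' \<subseteq> W" unfolding U'_def using that by blast
      then show ?thesis using True by auto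
    qed
    then show ?thesis using insert by blast
  next
    case False
    have "\<exists>\<mu>. shift_image U' \<mu> \<noteq> UNIV"
    proof (rule proper_shift_cyclic[OF U'(1,2) False, of v])
      show "W = UNIV" if "V.subspace W" "U' \<subseteq> W" "v \<in> W" "\<And>x. x \<in> W \<Longrightarrow> T x \<in> W" for W
        using that U' by (intro insert.prems(4)) auto
    qed
    then obtain \<mu> where "shift_image U' \<mu> \<noteq> UNIV" by blast
    then have "shift_image U \<mu> \<noteq> UNIV" using shift_image_mono[OF U'(3), of \<mu>] by auto
    then show ?thesis by blast
  qed
qed

end

section \<open>Uniqueness of the fixed vector\<close>

text \<open>In the application \<open>A h\<close> is the action of left multiplication by h,
  \<open>B b\<close> that of diag(1, b), \<theta> is conjugation by w, z is a uniformizer of F and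
  U0 is V(N). \<open>AB\<close> reflects that left multiplication by s in \<Delta> is diag(s,
  \<theta> s).\<close>

locale fixed_vector_setting = V: vector_space sV
  for sV :: "complex \<Rightarrow> 'v::ab_group_add \<Rightarrow> 'v" +
  fixes \<Delta> :: "'d::division_ring set" and A B :: "'d \<Rightarrow> 'v \<Rightarrow> 'v"
    and \<theta> :: "'d \<Rightarrow> 'd" and z :: 'd and U0 :: "'v set"
  assumes mult_closed: "\<And>a b. a \<in> \<Delta> \<Longrightarrow> b \<in> \<Delta> \<Longrightarrow> a * b \<in> \<Delta>"
    and inverse_closed: "\<And>a. a \<in> \<Delta> \<Longrightarrow> inverse a \<in> \<Delta>"
    and one_closed: "1 \<in> \<Delta>"
    and A_linear: "\<And>h. h \<noteq> 0 \<Longrightarrow> Vector_Spaces.linear sV sV (A h)"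
    and A_mult: "\<And>g h x. g \<noteq> 0 \<Longrightarrow> h \<noteq> 0 \<Longrightarrow> A (g * h) x = A g (A h x)"
    and A_one: "\<And>x. A 1 x = x"
    and B_linear: "\<And>b. b \<in> \<Delta> - {0} \<Longrightarrow> Vector_Spaces.linear sV sV (B b)"
    and B_mult: "\<And>b c x. b \<in> \<Delta> - {0} \<Longrightarrow> c \<in> \<Delta> - {0} \<Longrightarrow> B (b * c) x = B b (B c x)"
    and B_one: "\<And>x. B 1 x = x"
    and \<theta>_closed: "\<And>s. s \<in> \<Delta> - {0} \<Longrightarrow> \<theta> s \<in> \<Delta> - {0}"
    and \<theta>_mult: "\<And>s t. \<theta> (s * t) = \<theta> s * \<theta> t"
    and \<theta>_inverse: "\<And>s. \<theta> (inverse s) = inverse (\<theta> s)"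
    and \<theta>_surj: "\<And>b. b \<in> \<Delta> - {0} \<Longrightarrow> \<exists>s\<in>\<Delta> - {0}. \<theta> s = b"
    and AB: "\<And>s b x. s \<in> \<Delta> - {0} \<Longrightarrow> b \<in> \<Delta> - {0} \<Longrightarrow>
      A s (B b x) = B (\<theta> s * b * inverse (\<theta> s)) (A s x)"
    and subspace_U0: "V.subspace U0" and U0_proper: "U0 \<noteq> UNIV"
    and U0_B: "\<And>b x. b \<in> \<Delta> - {0} \<Longrightarrow> x \<in> U0 \<Longrightarrow> B b x \<in> U0"
    and U0_A: "\<And>s x. s \<in> \<Delta> - {0} \<Longrightarrow> x \<in> U0 \<Longrightarrow> A s x \<in> U0"
    and generate: "\<And>v U. v \<noteq> 0 \<Longrightarrow> (\<And>h. h \<noteq> 0 \<Longrightarrow> A h v = v) \<Longrightarrow> V.subspace U \<Longrightarrow> U0 \<subseteq> U \<Longrightarrow>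
      (\<And>b x. b \<in> \<Delta> - {0} \<Longrightarrow> x \<in> U \<Longrightarrow> B b x \<in> U) \<Longrightarrow> v \<in> U \<Longrightarrow> U = UNIV"
    and finite_orbit: "\<And>x. finite ((\<lambda>h. A h x) ` (- {0}))"
    and z: "z \<in> \<Delta> - {0}" and z_central: "\<And>b. b \<in> \<Delta> \<Longrightarrow> z * b = b * z"
    and finitely_generated: "\<And>x. \<exists>S. finite S \<and> (\<forall>W. V.subspace W \<longrightarrow> S \<subseteq> W \<longrightarrow>
      (\<forall>y\<in>W. B z y \<in> W \<and> B (inverse z) y \<in> W) \<longrightarrow> (\<forall>b\<in>\<Delta> - {0}. B b x \<in> W))"
begin

lemma \<Delta>_mult: "a \<in> \<Delta> - {0} \<Longrightarrow> b \<in> \<Delta> - {0} \<Longrightarrow> a * b \<in> \<Delta> - {0}"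
  and \<Delta>_inverse: "a \<in> \<Delta> - {0} \<Longrightarrow> inverse a \<in> \<Delta> - {0}"
  and \<Delta>_one: "1 \<in> \<Delta> - {0}"
  using mult_closed inverse_closed one_closed by auto

lemma A_hom: assumes "h \<noteq> 0"
  shows "A h (x + y) = A h x + A h y" "A h (x - y) = A h x - A h y" "A h (sV c x) = sV c (A h x)"
    "A h 0 = 0" "A h (sum f I) = (\<Sum>i\<in>I. A h (f i))"
proof -
  interpret Vector_Spaces.linear sV sV "A h" by (rule A_linear[OF assms])
  show "A h (x + y) = A h x + A h y" "A h (x - y) = A h x - A h y" "A h (sV c x) = sV c (A h x)"
    "A h 0 = 0" "A h (sum f I) = (\<Sum>i\<in>I. A h (f i))"
    by (rule add diff scale zero sum)+
qed

lemma B_hom: assumes "b \<in> \<Delta> - {0}"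
  shows "B b (x + y) = B b x + B b y" "B b (x - y) = B b x - B b y" "B b (sV c x) = sV c (B b x)"
    "B b 0 = 0" "B b (sum f I) = (\<Sum>i\<in>I. B b (f i))"
proof -
  interpret Vector_Spaces.linear sV sV "B b" by (rule B_linear[OF assms])
  show "B b (x + y) = B b x + B b y" "B b (x - y) = B b x - B b y" "B b (sV c x) = sV c (B b x)"
    "B b 0 = 0" "B b (sum f I) = (\<Sum>i\<in>I. B b (f i))"
    by (rule add diff scale zero sum)+
qed

lemma A_inverse: "h \<noteq> 0 \<Longrightarrow> A (inverse h) (A h x) = x"
  using A_mult[of "inverse h" h x] A_one by simp

text \<open>The span is B-stable, as the operators \<open>B b\<close> preserve U0 and permute the
  orbit of v; hence \<open>generate\<close> applies to it.\<close>

lemma span_U0_B_orbit: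
  assumes "v \<noteq> 0" "\<And>h. h \<noteq> 0 \<Longrightarrow> A h v = v"
  shows "V.span (U0 \<union> (\<lambda>b. B b v) ` (\<Delta> - {0})) = UNIV" (is "V.span ?G = UNIV")
proof (rule generate[OF assms])
  show "U0 \<subseteq> V.span ?G" by (auto intro: V.span_base)
  have "B 1 v \<in> V.span ?G" by (rule V.span_base) (use \<Delta>_one in blast)
  then show "v \<in> V.span ?G" by (simp add: B_one)
  fix b x assume b: "b \<in> \<Delta> - {0}" and "x \<in> V.span ?G"
  from this(2) show "B b x \<in> V.span ?G"
  proof (induction rule: V.span_induct_alt)
    case base
    then show ?case by (simp add: B_hom[OF b] V.span_zero)
  next
    case (step c x y)
    have "B b x \<in> V.span ?G"
    proof (cases "x \<in> U0")
      case True
      then show ?thesis using U0_B[OF b] by (auto intro: V.span_base)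
    next
      case False
      then obtain c where c: "c \<in> \<Delta> - {0}" "x = B c v" using step by blast
      then have "B b x = B (b * c) v" using B_mult[OF b] by simp
      then show ?thesis using \<Delta>_mult[OF b c(1)] by (auto intro: V.span_base)
    qed
    then show ?case using step by (auto simp: B_hom[OF b] intro: V.span_add V.span_scale)
  qed
qed (simp_all add: V.subspace_span)

text \<open>
  \<open>B\<close> of the average over \<open>h\<close> of \<open>\<Sum> a\<^sub>i h \<beta>\<^sub>i h\<^sup>-\<^sup>1\<close>, where \<open>v' \<equiv> \<Sum> a\<^sub>i B \<beta>\<^sub>i v\<close> modulo \<open>U0\<close>;
  it commutes with every \<open>B b\<close> because it is a class function.
\<close>

lemma intertwiner:
  assumes v: "v \<noteq> 0" "\<And>h. h \<noteq> 0 \<Longrightarrow> A h v = v" and v': "\<And>h. h \<noteq> 0 \<Longrightarrow> A h v' = v'"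
  shows "\<exists>T. Vector_Spaces.linear sV sV T \<and>
    (\<forall>U. V.subspace U \<and> (\<forall>b\<in>\<Delta> - {0}. \<forall>x\<in>U. B b x \<in> U) \<longrightarrow> (\<forall>x\<in>U. T x \<in> U)) \<and>
    T v - v' \<in> U0 \<and> (\<forall>b\<in>\<Delta> - {0}. \<forall>x. T (B b x) - B b (T x) \<in> U0)"
proof -
  let ?G = "(\<lambda>b. B b v) ` (\<Delta> - {0})"
  have "v' \<in> V.span (U0 \<union> ?G)" using span_U0_B_orbit[OF v] by simp
  then obtain u y where uy: "v' = u + y" "u \<in> V.span U0" "y \<in> V.span ?G"
    unfolding V.span_Un by blast
  from uy(3) obtain I a where I: "finite I" "I \<subseteq> ?G" "y = (\<Sum>t\<in>I. sV (a t) t)"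
    unfolding V.span_explicit by blast
  have "\<forall>t\<in>I. \<exists>b\<in>\<Delta> - {0}. t = B b v" using I(2) by blast
  then obtain \<beta> where \<beta>: "\<And>t. t \<in> I \<Longrightarrow> \<beta> t \<in> \<Delta> - {0}" "\<And>t. t \<in> I \<Longrightarrow> t = B (\<beta> t) v" by metis
  have y: "y - v' \<in> U0"
  proof -
    have "u \<in> U0" using uy(2) by (metis subspace_U0 V.span_eq_iff)
    then show ?thesis using uy(1) V.subspace_neg[OF subspace_U0] by auto
  qed
  \<comment> \<open>A finite substitute for averaging over \<open>\<Delta>\<^sup>\<times>\<close>:
    \<open>\<tau> h\<close> records the joint effect of h on the vectors of I, and only finitely
    many such records occur. The value 0 off I makes equal records equal functions.\<close>
  define \<tau> where "\<tau> h = (\<lambda>t. if t \<in> I then A h t else 0)" for h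
  define O' where "O' = \<tau> ` (\<Delta> - {0})"
  have finO: "finite O'"
  proof -
    let ?R = "\<Union>t\<in>I. (\<lambda>h. A h t) ` (- {0})"
    have "finite {f. \<forall>t. (t \<in> I \<longrightarrow> f t \<in> ?R) \<and> (t \<notin> I \<longrightarrow> f t = 0)}"
      using I(1) finite_orbit by (intro finite_set_of_finite_funs) auto
    moreover have "O' \<subseteq> {f. \<forall>t. (t \<in> I \<longrightarrow> f t \<in> ?R) \<and> (t \<notin> I \<longrightarrow> f t = 0)}"
      unfolding O'_def \<tau>_def by auto blast
    ultimately show ?thesis by (rule rev_finite_subset)
  qed
  have "O' \<noteq> {}" unfolding O'_def using \<Delta>_one by blast
  define n where "n = (of_nat (card O') :: complex)"
  have n: "n \<noteq> 0" using finO \<open>O' \<noteq> {}\<close> by (simp add: n_def card_eq_0_iff)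
  define r where "r = inv_into (\<Delta> - {0}) \<tau>"
  have r: "r f \<in> \<Delta> - {0}" "f = \<tau> (r f)" if "f \<in> O'" for f
    using that unfolding r_def O'_def by (rule inv_into_into, metis f_inv_into_f)
  \<comment> \<open>By \<open>AB\<close> and the invariance of v,
    \<open>B (\<gamma> f t) v = f t\<close>; so on v, though not necessarily elsewhere, T does not
    depend on the representatives \<open>r f\<close>.\<close>
  define \<gamma> where "\<gamma> f t = \<theta> (r f) * \<beta> t * inverse (\<theta> (r f))" for f t
  have \<gamma>: "\<gamma> f t \<in> \<Delta> - {0}" if "f \<in> O'" "t \<in> I" for f t
    unfolding \<gamma>_def using that by (intro \<Delta>_mult \<Delta>_inverse \<theta>_closed \<beta> r)
  define T where "T x = sV (inverse n) (\<Sum>f\<in>O'. \<Sum>t\<in>I. sV (a t) (B (\<gamma> f t) x))" for x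
  define \<Phi> where "\<Phi> f = (\<Sum>t\<in>I. sV (a t) (f t))" for f
  define e where "e = sV (inverse n) (\<Sum>f\<in>O'. \<Phi> f)"
  have AI: "A s t = B (\<theta> s * \<beta> t * inverse (\<theta> s)) v" if "s \<in> \<Delta> - {0}" "t \<in> I" for s t
  proof -
    have "A s t = A s (B (\<beta> t) v)" using \<beta>(2)[OF that(2)] by simp
    also have "\<dots> = B (\<theta> s * \<beta> t * inverse (\<theta> s)) (A s v)" using that \<beta>(1) by (intro AB)
    finally show ?thesis using v that by simp
  qed
  have T_B: "T (B b v) = B b e" if b: "b \<in> \<Delta> - {0}" for b
  proof -
    \<comment> \<open>Conjugating the coefficients by the inverse of b amounts to acting by the
      inverse of s on the records, which permutes \<open>O'\<close>.\<close>
    obtain s where s: "s \<in> \<Delta> - {0}" "\<theta> s = b" using \<theta>_surj[OF b] by blast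
    have si: "inverse s \<in> \<Delta> - {0}" by (rule \<Delta>_inverse[OF s(1)])
    have s0: "inverse s \<noteq> 0" using si by simp
    define F where "F f = (\<lambda>t. if t \<in> I then A (inverse s) (f t) else 0)" for f :: "'v \<Rightarrow> 'v"
    have F_\<tau>: "F (\<tau> h) = \<tau> (inverse s * h)" if "h \<in> \<Delta> - {0}" for h
      unfolding F_def \<tau>_def using A_mult[of "inverse s" h] s0 that by auto
    have "F ` O' \<subseteq> O'"
      unfolding O'_def using F_\<tau> \<Delta>_mult[OF si] by auto
    moreover have inj: "inj_on F O'"
    proof (rule inj_onI)
      fix f g assume fg: "f \<in> O'" "g \<in> O'" "F f = F g"
      show "f = g"
      proof
        fix t show "f t = g t"
        proof (cases "t \<in> I")
          case True
          then have "A (inverse s) (f t) = A (inverse s) (g t)"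
            using fun_cong[OF fg(3), of t] unfolding F_def by simp
          then show ?thesis using A_inverse[OF s0] by metis
        next
          case False
          then show ?thesis using fg(1,2) unfolding O'_def \<tau>_def by auto
        qed
      qed
    qed
    ultimately have FO: "F ` O' = O'" using finO by (simp add: endo_inj_surj)
    have "B (\<gamma> f t) (B b v) = B b (F f t)" if "f \<in> O'" "t \<in> I" for f t
    proof -
      have ri: "inverse s * r f \<in> \<Delta> - {0}" using si r(1)[OF that(1)] by (rule \<Delta>_mult)
      have bi: "inverse b \<in> \<Delta> - {0}" by (rule \<Delta>_inverse[OF b])
      have "F f t = \<tau> (inverse s * r f) t" using F_\<tau> r that by metis
      also have "\<dots> = A (inverse s * r f) t" using that by (simp add: \<tau>_def)
      also have "\<dots> = B (\<theta> (inverse s * r f) * \<beta> t * inverse (\<theta> (inverse s * r f))) v"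
        by (rule AI[OF ri that(2)])
      also have "\<theta> (inverse s * r f) * \<beta> t * inverse (\<theta> (inverse s * r f)) = inverse b * (\<gamma> f t * b)"
      proof -
        have "\<theta> (r f) \<noteq> 0" "b \<noteq> 0" using \<theta>_closed r(1) that b by auto
        then show ?thesis
          unfolding \<theta>_mult \<theta>_inverse s(2) \<gamma>_def
          by (simp add: mult.assoc nonzero_inverse_mult_distrib)
      qed
      finally have "B b (F f t) = B (b * (inverse b * (\<gamma> f t * b))) v"
        using B_mult[OF b \<Delta>_mult[OF bi \<Delta>_mult[OF \<gamma>[OF that] b]], of v] by simp
      also have "b * (inverse b * (\<gamma> f t * b)) = \<gamma> f t * b"
        using b by (simp add: mult.assoc[symmetric])
      finally show ?thesis using B_mult[OF \<gamma>[OF that] b] by simp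
    qed
    then have "T (B b v) = sV (inverse n) (\<Sum>f\<in>O'. \<Sum>t\<in>I. sV (a t) (B b (F f t)))"
      unfolding T_def by simp
    also have "\<dots> = B b (sV (inverse n) (\<Sum>f\<in>O'. \<Phi> (F f)))"
      by (simp add: B_hom[OF b] \<Phi>_def)
    also have "(\<Sum>f\<in>O'. \<Phi> (F f)) = (\<Sum>f\<in>O'. \<Phi> f)"
      using sum.reindex[OF inj, of \<Phi>] FO by simp
    finally show ?thesis unfolding e_def .
  qed
  have T_v: "T v = e" using T_B[OF \<Delta>_one] by (simp add: B_one)
  \<comment> \<open>Modulo U0, \<open>y\<close> agrees with v', and each \<open>\<Phi> f\<close> is
    a translate of \<open>y\<close> by an element of \<open>\<Delta>\<^sup>\<times>\<close>. As v'
    is fixed and U0 is stable, the average e still agrees with v'.\<close>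
  have e: "e - v' \<in> U0"
  proof -
    have "\<Phi> f - v' \<in> U0" if f: "f \<in> O'" for f
    proof -
      have h: "r f \<in> \<Delta> - {0}" "r f \<noteq> 0" using r(1)[OF f] by auto
      have "\<Phi> (\<tau> (r f)) = A (r f) y"
        unfolding \<Phi>_def I(3) \<tau>_def using h by (simp add: A_hom)
      then have "\<Phi> f - v' = A (r f) y - A (r f) v'" using r(2)[OF f] v'[OF h(2)] by simp
      also have "\<dots> = A (r f) (y - v')" by (simp add: A_hom[OF h(2)])
      finally show ?thesis using U0_A[OF h(1) y] by simp
    qed
    then have "sV (inverse n) (\<Sum>f\<in>O'. \<Phi> f - v') \<in> U0"
      by (intro V.subspace_scale V.subspace_sum subspace_U0)
    moreover have "(\<Sum>f\<in>O'. \<Phi> f - v') = (\<Sum>f\<in>O'. \<Phi> f) - sV n v'"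
      by (simp add: sum_subtractf n_def V.sum_constant_scale)
    ultimately show ?thesis using n by (simp add: e_def V.scale_right_diff_distrib)
  qed
  have T_linear: "Vector_Spaces.linear sV sV T"
  proof (rule Vector_Spaces.linear_iff[THEN iffD2, rule_format], intro conjI allI)
    show "vector_space sV" "vector_space sV" by (rule V.vector_space_axioms)+
    show "T (x + x') = T x + T x'" for x x'
      unfolding T_def using \<gamma> by (simp add: B_hom V.scale_right_distrib sum.distrib)
    show "T (sV c x) = sV c (T x)" for c x
      unfolding T_def using \<gamma> by (simp add: B_hom V.scale_sum_right mult.commute mult.left_commute)
  qed
  interpret T: Vector_Spaces.linear sV sV T by (rule T_linear)
  have T_stable: "T x \<in> U"
    if "V.subspace U" "\<And>b x. b \<in> \<Delta> - {0} \<Longrightarrow> x \<in> U \<Longrightarrow> B b x \<in> U" "x \<in> U" for U x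
    unfolding T_def using that \<gamma> by (intro V.subspace_scale V.subspace_sum that(1)) auto
  \<comment> \<open>Commutation comes from \<open>T_B\<close> at v only. The set of vectors where it
    holds modulo U0 contains U0 and v and is B-stable, so it is everything by
    \<open>generate\<close>.\<close>
  have C: "{x. \<forall>b\<in>\<Delta> - {0}. T (B b x) - B b (T x) \<in> U0} = UNIV" (is "?C = _")
  proof (rule generate[OF v])
    show "V.subspace ?C"
    proof (rule V.subspaceI)
      show "0 \<in> ?C" by (auto simp: B_hom T.zero V.subspace_0[OF subspace_U0])
      show "x + x' \<in> ?C" if "x \<in> ?C" "x' \<in> ?C" for x x'
      proof (intro CollectI ballI)
        fix b assume b: "b \<in> \<Delta> - {0}"
        have "T (B b (x + x')) - B b (T (x + x')) = (T (B b x) - B b (T x)) + (T (B b x') - B b (T x'))"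
          by (simp add: B_hom[OF b] T.add)
        then show "T (B b (x + x')) - B b (T (x + x')) \<in> U0"
          using that b V.subspace_add[OF subspace_U0] by simp
      qed
      show "sV c x \<in> ?C" if "x \<in> ?C" for c x
      proof (intro CollectI ballI)
        fix b assume b: "b \<in> \<Delta> - {0}"
        have "T (B b (sV c x)) - B b (T (sV c x)) = sV c (T (B b x) - B b (T x))"
          by (simp add: B_hom[OF b] T.scale V.scale_right_diff_distrib)
        then show "T (B b (sV c x)) - B b (T (sV c x)) \<in> U0"
          using that b V.subspace_scale[OF subspace_U0] by simp
      qed
    qed
    show "U0 \<subseteq> ?C"
    proof (intro subsetI CollectI ballI)
      fix x b assume x: "x \<in> U0" and b: "b \<in> \<Delta> - {0}"
      show "T (B b x) - B b (T x) \<in> U0"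
        by (intro V.subspace_diff subspace_U0 U0_B T_stable b x)
    qed
    show "v \<in> ?C" using T_B T_v V.subspace_0[OF subspace_U0] by auto
    fix c x assume c: "c \<in> \<Delta> - {0}" and x: "x \<in> ?C"
    show "B c x \<in> ?C"
    proof (intro CollectI ballI)
      fix b assume b: "b \<in> \<Delta> - {0}"
      \<comment> \<open>The defect E(b, x) = T B_b x - B_b T x satisfies E(b, B_c x) = E(bc, x) -
        B_b E(c, x).\<close>
      have "T (B b (B c x)) - B b (T (B c x))
          = (T (B (b * c) x) - B (b * c) (T x)) - B b (T (B c x) - B c (T x))"
        by (simp add: B_mult[OF b c] B_hom[OF b])
      also have "\<dots> \<in> U0"
      proof (rule V.subspace_diff[OF subspace_U0])
        show "T (B (b * c) x) - B (b * c) (T x) \<in> U0" using x \<Delta>_mult[OF b c] by simp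
        show "B b (T (B c x) - B c (T x)) \<in> U0" using x c by (intro U0_B[OF b]) simp
      qed
      finally show "T (B b (B c x)) - B b (T (B c x)) \<in> U0" .
    qed
  qed
  have comm: "T (B b x) - B b (T x) \<in> U0" if "b \<in> \<Delta> - {0}" for b x
  proof -
    have "x \<in> ?C" unfolding C by simp
    then show ?thesis using that by simp
  qed
  show ?thesis
  proof (intro exI[of _ T] conjI allI impI ballI)
    show "Vector_Spaces.linear sV sV T" by (rule T_linear)
    show "T x \<in> U" if "V.subspace U \<and> (\<forall>b\<in>\<Delta> - {0}. \<forall>x\<in>U. B b x \<in> U)" "x \<in> U" for U x
      using that by (intro T_stable[of U x]) simp_all
    show "T v - v' \<in> U0" using e T_v by simp
    show "T (B b x) - B b (T x) \<in> U0" if "b \<in> \<Delta> - {0}" for b x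
      by (rule comm[OF that])
  qed
qed

text \<open>It suffices to find c and a proper B-stable subspace that contains U0 and v' - c v, for
  \<open>generate\<close> then excludes a nonzero difference. The space is built in two stages:
  first Y is made a scalar, then c is chosen so that T - c is not surjective on the
  quotient.\<close>

theorem fixed_vector_unique:
  assumes v: "v \<noteq> 0" "\<And>h. h \<noteq> 0 \<Longrightarrow> A h v = v" and v': "\<And>h. h \<noteq> 0 \<Longrightarrow> A h v' = v'"
  shows "\<exists>c. v' = sV c v"
proof -
  obtain T where T0: "Vector_Spaces.linear sV sV T \<and>
    (\<forall>U. V.subspace U \<and> (\<forall>b\<in>\<Delta> - {0}. \<forall>x\<in>U. B b x \<in> U) \<longrightarrow> (\<forall>x\<in>U. T x \<in> U)) \<and>
    T v - v' \<in> U0 \<and> (\<forall>b\<in>\<Delta> - {0}. \<forall>x. T (B b x) - B b (T x) \<in> U0)"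
    using intertwiner[OF v v'] ..
  have T: "Vector_Spaces.linear sV sV T" "T v - v' \<in> U0"
    "\<And>b x. b \<in> \<Delta> - {0} \<Longrightarrow> T (B b x) - B b (T x) \<in> U0" using T0 by simp_all
  have T_stable: "T x \<in> U"
    if "V.subspace U" "\<And>b x. b \<in> \<Delta> - {0} \<Longrightarrow> x \<in> U \<Longrightarrow> B b x \<in> U" "x \<in> U" for U x
    using T0 that by simp
  interpret T: complex_endomorphism sV T
    using T(1) V.vector_space_axioms by (simp add: complex_endomorphism_def)
  have zi: "inverse z \<in> \<Delta> - {0}" by (rule \<Delta>_inverse[OF z])
  have z0: "z \<noteq> 0" using z by simp
  have Bz: "B z (B (inverse z) x) = x" "B (inverse z) (B z x) = x" for x
    using B_mult[OF z zi, of x] B_mult[OF zi z, of x] z0 B_one by simp_all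
  \<comment> \<open>\<open>\<complex>[z, z\<^sup>-\<^sup>1]\<close> is finite over \<open>\<complex>[z + z\<^sup>-\<^sup>1]\<close>, so nonnegative powers of \<open>Y\<close> suffice.\<close>
  define Y where "Y x = B z x + B (inverse z) x" for x
  interpret Y: complex_endomorphism sV Y
    unfolding complex_endomorphism_def Vector_Spaces.linear_iff
    using V.vector_space_axioms
    by (auto simp: Y_def B_hom[OF z] B_hom[OF zi] V.scale_right_distrib)
  have BY: "B b (Y x) = Y (B b x)" if b: "b \<in> \<Delta> - {0}" for b x
  proof -
    have zb: "z * b = b * z" using z_central b by simp
    have "inverse z * b = inverse z * (b * z) * inverse z" using z0 by (simp add: mult.assoc)
    also have "\<dots> = b * inverse z"
      using z0 by (simp add: zb[symmetric] mult.assoc[symmetric])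
    finally have "B b (B z x) = B z (B b x)" "B b (B (inverse z) x) = B (inverse z) (B b x)"
      using zb by (simp_all flip: B_mult[OF b z] B_mult[OF z b] B_mult[OF b zi] B_mult[OF zi b])
    then show ?thesis by (simp add: Y_def B_hom[OF b])
  qed
  obtain S where S: "finite S" and fg: "\<forall>W. V.subspace W \<longrightarrow> S \<subseteq> W \<longrightarrow>
      (\<forall>y\<in>W. B z y \<in> W \<and> B (inverse z) y \<in> W) \<longrightarrow> (\<forall>b\<in>\<Delta> - {0}. B b v \<in> W)"
    using finitely_generated[of v] by (elim exE conjE)
  have gen: "B b v \<in> W" if "V.subspace W" "S \<subseteq> W"
      "\<And>y. y \<in> W \<Longrightarrow> B z y \<in> W \<and> B (inverse z) y \<in> W" "b \<in> \<Delta> - {0}" for W b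
    by (rule fg[rule_format, OF that(1,2) _ that(4)]) (rule that(3))
  define S' where "S' = S \<union> B z ` S"
  have gen': "W = UNIV" if W: "V.subspace W" "U0 \<subseteq> W" "S' \<subseteq> W" "\<And>x. x \<in> W \<Longrightarrow> Y x \<in> W" for W
  proof -
    \<comment> \<open>Stability of W' under z and its inverse comes from z^2 = Y z - 1 and z^-1 = Y
      - z. The image of S under \<open>B z\<close> was put into \<open>S'\<close> so that S lies in
      W'.\<close>
    define W' where "W' = {x \<in> W. B z x \<in> W}"
    have sub: "V.subspace W'"
      unfolding W'_def
      by (rule V.subspaceI)
        (use W(1) in \<open>auto simp: B_hom[OF z] V.subspace_0 V.subspace_add V.subspace_scale\<close>)
    have "B b v \<in> W'" if "b \<in> \<Delta> - {0}" for b
    proof (rule gen[OF sub _ _ that])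
      show "S \<subseteq> W'" using W(3) unfolding S'_def W'_def by auto
      fix x assume "x \<in> W'"
      then have x: "x \<in> W" "B z x \<in> W" unfolding W'_def by auto
      have "B z (B z x) \<in> W" "B (inverse z) x \<in> W"
        using V.subspace_diff[OF W(1) W(4)[OF x(2)] x(1)] V.subspace_diff[OF W(1) W(4)[OF x(1)] x(2)]
        by (simp_all add: Y_def Bz)
      then show "B z x \<in> W' \<and> B (inverse z) x \<in> W'"
        unfolding W'_def using x by (simp add: Bz)
    qed
    then have "U0 \<union> (\<lambda>b. B b v) ` (\<Delta> - {0}) \<subseteq> W" using W(2) unfolding W'_def by auto
    then have "V.span (U0 \<union> (\<lambda>b. B b v) ` (\<Delta> - {0})) \<subseteq> W" using W(1) by (rule V.span_minimal)
    then show ?thesis using span_U0_B_orbit[OF v] by auto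
  qed
  have fin: "finite S'" unfolding S'_def using S by simp
  have YU0: "Y x \<in> U0" if "x \<in> U0" for x
    unfolding Y_def using that by (intro V.subspace_add subspace_U0 U0_B z zi)
  have "\<exists>\<mu>. Y.shift_image U0 \<mu> \<noteq> UNIV"
  proof (rule Y.proper_shift[OF fin subspace_U0 _ U0_proper])
    show "W = UNIV" if "V.subspace W" "U0 \<subseteq> W" "S' \<subseteq> W" "\<And>x. x \<in> W \<Longrightarrow> Y x \<in> W" for W
      by (rule gen'[OF that])
  qed (rule YU0)
  then obtain \<mu> where \<mu>: "Y.shift_image U0 \<mu> \<noteq> UNIV" ..
  \<comment> \<open>Modulo U1, Y is the scalar \<mu>. Since Y commutes with all \<open>B b\<close>,
    U1 is again B-stable.\<close>
  define U1 where "U1 = Y.shift_image U0 \<mu>"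
  have U1: "V.subspace U1" "U1 \<noteq> UNIV" "U0 \<subseteq> U1"
    unfolding U1_def using \<mu> Y.subspace_shift_image[OF subspace_U0] Y.subset_shift_image by auto
  have U1_B: "B b x \<in> U1" if b: "b \<in> \<Delta> - {0}" and x: "x \<in> U1" for b x
  proof -
    obtain u y where u: "u \<in> U0" "x = u + (Y y - sV \<mu> y)"
      using x unfolding U1_def Y.shift_image_def by blast
    then have "B b x = B b u + (Y (B b y) - sV \<mu> (B b y))"
      by (simp add: B_hom[OF b] BY[OF b])
    then show ?thesis using U0_B[OF b u(1)] unfolding U1_def Y.shift_image_def by blast
  qed
  \<comment> \<open>A subspace containing U1 is automatically Y-stable, so by \<open>gen'\<close>
    the finite set \<open>S'\<close> spans V/U1.\<close>
  have gen1: "W = UNIV" if W: "V.subspace W" "U1 \<subseteq> W" "S' \<subseteq> W" "\<And>x. x \<in> W \<Longrightarrow> T x \<in> W" for W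
  proof (rule gen'[OF W(1) _ W(3)])
    show "U0 \<subseteq> W" using U1(3) W(2) by blast
    fix x assume x: "x \<in> W"
    have "Y x - sV \<mu> x \<in> W"
      using Y.shift_in_shift_image[OF subspace_U0] W(2) unfolding U1_def by (rule set_rev_mp)
    then have "(Y x - sV \<mu> x) + sV \<mu> x \<in> W" by (intro V.subspace_add V.subspace_scale W(1) x)
    then show "Y x \<in> W" by simp
  qed
  have "\<exists>c. T.shift_image U1 c \<noteq> UNIV"
  proof (rule T.proper_shift[OF fin U1(1) _ U1(2)])
    show "T x \<in> U1" if "x \<in> U1" for x
      by (rule T_stable[OF U1(1) U1_B that])
    show "W = UNIV" if "V.subspace W" "U1 \<subseteq> W" "S' \<subseteq> W" "\<And>x. x \<in> W \<Longrightarrow> T x \<in> W" for W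
      by (rule gen1[OF that])
  qed
  then obtain c where c: "T.shift_image U1 c \<noteq> UNIV" ..
  define U2 where "U2 = T.shift_image U1 c"
  have U2: "V.subspace U2" "U2 \<noteq> UNIV" "U1 \<subseteq> U2"
    unfolding U2_def using c T.subspace_shift_image[OF U1(1)] T.subset_shift_image by auto
  have U2_B: "B b x \<in> U2" if b: "b \<in> \<Delta> - {0}" and x: "x \<in> U2" for b x
  proof -
    obtain u y where u: "u \<in> U1" "x = u + (T y - sV c y)"
      using x unfolding U2_def T.shift_image_def by blast
    \<comment> \<open>T commutes with \<open>B b\<close> only modulo U0; the defect is moved into
      the component in U1, which contains U0.\<close>
    have "B b x = (B b u - (T (B b y) - B b (T y))) + (T (B b y) - sV c (B b y))"
      unfolding u(2) by (simp add: B_hom[OF b])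
    moreover have "B b u - (T (B b y) - B b (T y)) \<in> U1"
      using T(3)[OF b, of y] U1(3) by (intro V.subspace_diff[OF U1(1) U1_B[OF b u(1)]]) blast
    ultimately show ?thesis unfolding U2_def T.shift_image_def by blast
  qed
  have "v' - sV c v = (T v - sV c v) - (T v - v')" by simp
  also have "\<dots> \<in> U2"
  proof (rule V.subspace_diff[OF U2(1)])
    show "T v - sV c v \<in> U2" unfolding U2_def by (rule T.shift_in_shift_image[OF U1(1)])
    show "T v - v' \<in> U2" using T(2) U1(3) U2(3) by auto
  qed
  finally have mem: "v' - sV c v \<in> U2" .
  have fixed: "A h (v' - sV c v) = v' - sV c v" if "h \<noteq> 0" for h
    using v(2)[OF that] v'[OF that] by (simp add: A_hom[OF that])
  have "v' - sV c v = 0"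
  proof (rule ccontr)
    assume nz: "v' - sV c v \<noteq> 0"
    have sub: "U0 \<subseteq> U2" using U1(3) U2(3) by (rule order_trans)
    have "U2 = UNIV" by (rule generate[OF nz fixed U2(1) sub U2_B mem])
    then show False using U2(2) by simp
  qed
  then show ?thesis by auto
qed

end

section \<open>Compactness of the unit sphere\<close>

text \<open>Positivity rules out the default 0 in the definition of \<open>dim\<close> and the value
  0 of \<open>card\<close> on infinite sets, so the basis chosen there is finite.\<close>

lemma dim_over_basis:
  assumes i: "ring_embedding i" and dim: "dim_over i > 0"
  shows "\<exists>B. finite B \<and> card B = dim_over i \<and> module.span (\<lambda>a x. i a * x) B = UNIV"
proof -
  interpret D: vector_space "\<lambda>a x. i a * x" using i by (rule vector_space_embedding)
  let ?P = "\<lambda>b. D.independent b \<and> D.span b = D.span UNIV"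
  have ex: "\<exists>b. ?P b" using dim unfolding dim_over_def D.dim_def by (auto split: if_splits)
  then have "?P (SOME b. ?P b)" by (rule someI_ex)
  moreover have card: "card (SOME b. ?P b) = dim_over i"
    using ex unfolding dim_over_def D.dim_def by simp
  moreover have "finite (SOME b. ?P b)"
    using dim unfolding card[symmetric] by (simp add: card_gt_0_iff)
  ultimately show ?thesis using D.span_UNIV by blast
qed

section \<open>Valuation arithmetic in a local field\<close>

locale local_field =
  fixes v :: "'f::field \<Rightarrow> int"
  assumes local_field: "nonarch_local_field v"
begin

lemma v_mult: "x \<noteq> 0 \<Longrightarrow> y \<noteq> 0 \<Longrightarrow> v (x * y) = v x + v y"
  and v_add: "x \<noteq> 0 \<Longrightarrow> y \<noteq> 0 \<Longrightarrow> x + y \<noteq> 0 \<Longrightarrow> min (v x) (v y) \<le> v (x + y)"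
  and uniformizer: "\<exists>x. x \<noteq> 0 \<and> v x = 1"
  and complete: "(\<And>n. \<exists>N. \<forall>m\<ge>N. \<forall>k\<ge>N. X m - X k \<in> val_ball v n) \<Longrightarrow>
        (\<exists>l. \<forall>n. \<exists>N. \<forall>m\<ge>(N::nat). X m - l \<in> val_ball v n)"
  and finite_residue_field:
    "finite (val_ring v // {(x, y). x \<in> val_ring v \<and> y \<in> val_ring v \<and> x - y \<in> val_ideal v})"
  using local_field unfolding nonarch_local_field_def by simp_all

lemma v_1: "v 1 = 0"
  using v_mult[of 1 1] by simp

lemma v_minus: "v (- x) = v x"
proof (cases "x = 0")
  case False
  have "v (- 1) + v (- 1) = 0" using v_mult[of "- 1" "- 1"] v_1 by simp
  then show ?thesis using v_mult[of "- 1" x] False by simp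
qed simp

lemma v_inverse: "x \<noteq> 0 \<Longrightarrow> v (inverse x) = - v x"
  using v_mult[of x "inverse x"] v_1 by simp

lemma v_power_int: "x \<noteq> 0 \<Longrightarrow> v (power_int x k) = k * v x"
proof -
  assume x: "x \<noteq> 0"
  have "v (x ^ n) = int n * v x" for n
    by (induction n) (use x v_1 v_mult in \<open>simp_all add: algebra_simps\<close>)
  then show ?thesis using x v_inverse[of "x ^ nat (- k)"] by (simp add: power_int_def power_inverse)
qed

lemma val_ball_0: "0 \<in> val_ball v n"
  by (simp add: val_ball_def)

lemma val_ball_add: "x \<in> val_ball v n \<Longrightarrow> y \<in> val_ball v n \<Longrightarrow> x + y \<in> val_ball v n"
  unfolding val_ball_def using v_add[of x y] by (cases "x = 0"; cases "y = 0"; cases "x + y = 0") auto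

lemma val_ball_minus: "x \<in> val_ball v n \<Longrightarrow> - x \<in> val_ball v n"
  unfolding val_ball_def using v_minus by auto

lemma val_ball_diff: "x \<in> val_ball v n \<Longrightarrow> y \<in> val_ball v n \<Longrightarrow> x - y \<in> val_ball v n"
  using val_ball_add[of x n "- y"] val_ball_minus by simp

lemma val_ball_mult_iff: "a \<noteq> 0 \<Longrightarrow> a * x \<in> val_ball v (v a + n) \<longleftrightarrow> x \<in> val_ball v n"
  unfolding val_ball_def using v_mult[of a x] by (cases "x = 0") auto

section \<open>Compactness of the integers and of the sphere\<close>

lemma residue_representatives:
  "\<exists>R. finite R \<and> (\<forall>x\<in>val_ring v. \<exists>r\<in>R. x - r \<in> val_ideal v)"
proof -
  let ?E = "{(x, y). x \<in> val_ring v \<and> y \<in> val_ring v \<and> x - y \<in> val_ideal v}"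
  define R where "R = (\<lambda>C. SOME r. r \<in> C) ` (val_ring v // ?E)"
  have "\<exists>r\<in>R. x - r \<in> val_ideal v" if x: "x \<in> val_ring v" for x
  proof
    have "x \<in> ?E `` {x}" using x val_ball_0 by auto
    then have "(SOME r. r \<in> ?E `` {x}) \<in> ?E `` {x}" by (rule someI)
    then show "x - (SOME r. r \<in> ?E `` {x}) \<in> val_ideal v" by auto
    show "(SOME r. r \<in> ?E `` {x}) \<in> R" unfolding R_def using x by (intro imageI quotientI)
  qed
  moreover have "finite R" unfolding R_def using finite_residue_field by simp
  ultimately show ?thesis by blast
qed

text \<open>
  Koenig's argument: were the image infinite, it would remain so on a nested sequence of balls, and
  local constancy fails at their common point.
\<close>

lemma finite_image_locally_constant:
  fixes g :: "('b \<Rightarrow> 'f) \<Rightarrow> 'x" and I :: "'b set"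
  defines "C \<equiv> {c. \<forall>b\<in>I. c b \<in> val_ring v}"
  assumes I: "finite I"
    and g: "\<And>c. c \<in> C \<Longrightarrow> \<exists>n. \<forall>c'\<in>C. (\<forall>b\<in>I. c' b - c b \<in> val_ball v n) \<longrightarrow> g c' = g c"
  shows "finite (g ` C)"
proof (rule ccontr)
  assume inf: "infinite (g ` C)"
  define K where "K c n = {c' \<in> C. \<forall>b\<in>I. c' b - c b \<in> val_ball v (int n)}" for c n
  have step: "\<exists>c'. infinite (g ` K c' (Suc n)) \<and> (\<forall>b\<in>I. c' b - c b \<in> val_ball v (int n))"
    if c: "infinite (g ` K c n)" for c n
  proof -
    obtain \<omega> where \<omega>: "\<omega> \<noteq> 0" "v \<omega> = 1" using uniformizer by blast
    obtain R where R: "finite R" "\<forall>x\<in>val_ring v. \<exists>r\<in>R. x - r \<in> val_ideal v"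
      using residue_representatives by (elim exE conjE)
    define a where "a = \<omega> ^ n"
    have a: "a \<noteq> 0" "v a = int n" using \<omega> v_power_int[of \<omega> "int n"] by (auto simp: a_def)
    define P where "P = PiE I (\<lambda>_. R)"
    have P: "finite P" unfolding P_def using I R(1) by (rule finite_PiE)
    define \<kappa> where "\<kappa> \<rho> = (\<lambda>b. c b + a * \<rho> b)" for \<rho>
    \<comment> \<open>Finiteness of the residue field covers a ball of level n by finitely many
      balls of level n + 1, with centres c + a \<rho>; one of them must keep an infinite
      image.\<close>
    have "K c n \<subseteq> (\<Union>\<rho>\<in>P. K c n \<inter> K (\<kappa> \<rho>) (Suc n))"
    proof
      fix c' assume c': "c' \<in> K c n"
      have "\<exists>r\<in>R. (c' b - c b) / a - r \<in> val_ideal v" if "b \<in> I" for b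
      proof (rule R(2)[rule_format])
        have "c' b - c b \<in> val_ball v (int n)" using c' that unfolding K_def by blast
        then show "(c' b - c b) / a \<in> val_ring v"
          using val_ball_mult_iff[OF a(1), of "(c' b - c b) / a" 0] a by simp
      qed
      then obtain r where r: "\<And>b. b \<in> I \<Longrightarrow> r b \<in> R \<and> (c' b - c b) / a - r b \<in> val_ideal v" by metis
      define \<rho> where "\<rho> = restrict r I"
      have "\<rho> \<in> P" unfolding P_def \<rho>_def using r by auto
      moreover have "c' \<in> K (\<kappa> \<rho>) (Suc n)"
        unfolding K_def
      proof (intro CollectI conjI ballI)
        show "c' \<in> C" using c' unfolding K_def by blast
        fix b assume b: "b \<in> I"
        have "a * ((c' b - c b) / a - r b) \<in> val_ball v (int n + 1)"
          using val_ball_mult_iff[OF a(1), of "(c' b - c b) / a - r b" 1] r[OF b] a by simp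
        moreover have "a * ((c' b - c b) / a - r b) = c' b - \<kappa> \<rho> b"
          using a b by (simp add: \<kappa>_def \<rho>_def field_simps)
        ultimately show "c' b - \<kappa> \<rho> b \<in> val_ball v (int (Suc n))" by (simp add: add.commute)
      qed
      ultimately show "c' \<in> (\<Union>\<rho>\<in>P. K c n \<inter> K (\<kappa> \<rho>) (Suc n))" using c' by blast
    qed
    then have "g ` K c n \<subseteq> (\<Union>\<rho>\<in>P. g ` (K c n \<inter> K (\<kappa> \<rho>) (Suc n)))" by blast
    then have "\<not> (\<forall>\<rho>\<in>P. finite (g ` (K c n \<inter> K (\<kappa> \<rho>) (Suc n))))"
      using c P by (meson finite_UN finite_subset)
    then obtain \<rho> where \<rho>: "infinite (g ` (K c n \<inter> K (\<kappa> \<rho>) (Suc n)))" by blast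
    \<comment> \<open>The centre \<open>\<kappa> \<rho>\<close> need not be close to c. Any point of
      the intersection can serve as centre instead, as the balls are ultrametric.\<close>
    then obtain c' where c': "c' \<in> K c n" "c' \<in> K (\<kappa> \<rho>) (Suc n)"
      by (metis Int_emptyI empty_iff finite.emptyI image_empty)
    have "K c n \<inter> K (\<kappa> \<rho>) (Suc n) \<subseteq> K c' (Suc n)"
    proof
      fix c'' assume c'': "c'' \<in> K c n \<inter> K (\<kappa> \<rho>) (Suc n)"
      have "c'' b - c' b \<in> val_ball v (int (Suc n))" if "b \<in> I" for b
        using val_ball_diff[of "c'' b - \<kappa> \<rho> b" "int (Suc n)" "c' b - \<kappa> \<rho> b"] c' c'' that
        unfolding K_def by auto
      then show "c'' \<in> K c' (Suc n)" using c'' unfolding K_def by auto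
    qed
    then have "infinite (g ` K c' (Suc n))" using \<rho> by (meson finite_subset image_mono)
    moreover have "\<forall>b\<in>I. c' b - c b \<in> val_ball v (int n)" using c' unfolding K_def by blast
    ultimately show ?thesis by blast
  qed
  have inf0: "infinite (g ` K (\<lambda>_. 0) 0)" using inf unfolding K_def C_def by simp
  have "\<exists>x. \<forall>n. infinite (g ` K (x n) n) \<and> (\<forall>b\<in>I. x (Suc n) b - x n b \<in> val_ball v (int n))"
  proof (rule dependent_nat_choice)
    show "\<exists>x. infinite (g ` K x 0)" using inf0 by blast
    show "\<exists>y. infinite (g ` K y (Suc n)) \<and> (\<forall>b\<in>I. y b - x b \<in> val_ball v (int n))"
      if "infinite (g ` K x n)" for x n by (rule step[OF that])
  qed
  then obtain x where "\<forall>n. infinite (g ` K (x n) n) \<and> (\<forall>b\<in>I. x (Suc n) b - x n b \<in> val_ball v (int n))" ..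
  then have x: "\<And>n. infinite (g ` K (x n) n)"
    "\<And>n b. b \<in> I \<Longrightarrow> x (Suc n) b - x n b \<in> val_ball v (int n)" by simp_all
  have x_diff: "x (n + k) b - x n b \<in> val_ball v (int n)" if b: "b \<in> I" for n k b
  proof (induction k)
    case 0
    then show ?case by (simp add: val_ball_0)
  next
    case (Suc k)
    have "x (Suc (n + k)) b - x (n + k) b \<in> val_ball v (int n)"
      using x(2)[OF b, of "n + k"] val_ball_mono[of "int n" "int (n + k)" v] by auto
    then have "(x (Suc (n + k)) b - x (n + k) b) + (x (n + k) b - x n b) \<in> val_ball v (int n)"
      using Suc by (rule val_ball_add)
    then show ?case by simp
  qed
  have "\<exists>l. \<forall>n. x n b - l \<in> val_ball v (int n)" if b: "b \<in> I" for b
  proof -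
    have "\<exists>N. \<forall>m\<ge>N. \<forall>k\<ge>N. x m b - x k b \<in> val_ball v n" for n
    proof (intro exI allI impI)
      fix m k assume mk: "nat n \<le> m" "nat n \<le> k"
      have "x m b - x (nat n) b \<in> val_ball v (int (nat n))"
        "x k b - x (nat n) b \<in> val_ball v (int (nat n))"
        using x_diff[OF b, of "nat n" "m - nat n"] x_diff[OF b, of "nat n" "k - nat n"] mk by auto
      then have "(x m b - x (nat n) b) - (x k b - x (nat n) b) \<in> val_ball v (int (nat n))"
        by (rule val_ball_diff)
      moreover have "val_ball v (int (nat n)) \<subseteq> val_ball v n" by (rule val_ball_mono) simp
      ultimately show "x m b - x k b \<in> val_ball v n" by auto
    qed
    then obtain l where l: "\<And>n. \<exists>N. \<forall>m\<ge>N. x m b - l \<in> val_ball v n"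
      using complete[of "\<lambda>n. x n b"] by blast
    \<comment> \<open>The limit is as close to \<open>x n\<close> as all later terms are, by the
      ultrametric inequality at one late index \<open>n + N\<close>.\<close>
    have "x n b - l \<in> val_ball v (int n)" for n
    proof -
      obtain N where N: "\<And>m. m \<ge> N \<Longrightarrow> x m b - l \<in> val_ball v (int n)" using l by blast
      have "(x (n + N) b - l) - (x (n + N) b - x n b) \<in> val_ball v (int n)"
        by (rule val_ball_diff[OF N x_diff[OF b]]) simp
      then show ?thesis by simp
    qed
    then show ?thesis by blast
  qed
  then obtain l where l: "\<And>b n. b \<in> I \<Longrightarrow> x n b - l b \<in> val_ball v (int n)" by metis
  have K_l: "K (x n) n \<subseteq> K l n" for n
  proof
    fix c assume c: "c \<in> K (x n) n"
    have "c b - l b \<in> val_ball v (int n)" if "b \<in> I" for b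
      using val_ball_add[of "c b - x n b" "int n" "x n b - l b"] c l[OF that] that
      unfolding K_def by auto
    then show "c \<in> K l n" using c unfolding K_def by auto
  qed
  have "l \<in> C"
  proof -
    obtain c where c: "c \<in> K (x 0) 0" using x(1)[of 0] by (metis equals0I finite.emptyI image_empty)
    then have cl: "c \<in> C" "c \<in> K l 0" using K_l[of 0] unfolding K_def by auto
    have "l b \<in> val_ring v" if "b \<in> I" for b
      using val_ball_diff[of "c b" 0 "c b - l b"] cl that unfolding K_def C_def by auto
    then show ?thesis unfolding C_def by blast
  qed
  then obtain n where n: "\<And>c'. c' \<in> C \<Longrightarrow> (\<forall>b\<in>I. c' b - l b \<in> val_ball v n) \<Longrightarrow> g c' = g l"
    using g by blast
  \<comment> \<open>The level n may be negative, whereas the nested balls are indexed by naturals;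
    passing to \<open>nat n\<close> only shrinks the ball.\<close>
  have "g c = g l" if "c \<in> K (x (nat n)) (nat n)" for c
  proof -
    have c: "c \<in> K l (nat n)" using K_l that by blast
    have "val_ball v (int (nat n)) \<subseteq> val_ball v n" by (rule val_ball_mono) simp
    then have "\<forall>b\<in>I. c b - l b \<in> val_ball v n" using c unfolding K_def by blast
    then show ?thesis using c unfolding K_def by (intro n) auto
  qed
  then have "g ` K (x (nat n)) (nat n) \<subseteq> {g l}" by blast
  then show False using x(1)[of "nat n"] by (meson finite.emptyI finite_insert finite_subset)
qed

text \<open>A nonzero vector is a power of \<omega> times one whose coordinates are integral and not
  all in the maximal ideal. These vectors form a compact sphere S, on which f is locally constant
  and thus takes finitely many values.\<close>

lemma finite_modulo_scalars:
  fixes i :: "'f \<Rightarrow> 'd::division_ring" and X :: "'d set" and f :: "'d \<Rightarrow> 'x"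
  assumes i: "ring_embedding i" and D: "dim_over i > 0"
    and X: "module.subspace (\<lambda>a x. i a * x) X"
    and \<omega>: "\<omega> \<noteq> 0" "v \<omega> = 1"
    and f: "\<And>x B. x \<in> X - {0} \<Longrightarrow> finite B \<Longrightarrow> B \<subseteq> X \<Longrightarrow> \<exists>n. \<forall>c. (\<forall>b\<in>B. c b \<in> val_ball v n) \<longrightarrow>
      x + (\<Sum>b\<in>B. i (c b) * b) \<noteq> 0 \<longrightarrow> f (x + (\<Sum>b\<in>B. i (c b) * b)) = f x"
  obtains S where "S \<subseteq> X - {0}" "finite (f ` S)"
    "\<And>x. x \<in> X - {0} \<Longrightarrow> \<exists>k. \<exists>s\<in>S. x = i (power_int \<omega> k) * s"
proof -
  interpret D: vector_space "\<lambda>a x. i a * x" using i by (rule vector_space_embedding)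
  obtain B0 where B0: "finite B0" "D.span B0 = UNIV"
    using dim_over_basis[OF i D] by blast
  obtain B where B: "B \<subseteq> X" "D.independent B" "X \<subseteq> D.span B"
    using D.maximal_independent_subset[of X] by blast
  have fin: "finite B"
    using D.independent_span_bound[OF B0(1) B(2)] B0(2) by simp
  define \<Sigma> where "\<Sigma> c = (\<Sum>b\<in>B. i (c b) * b)" for c
  have \<Sigma>_X: "\<Sigma> c \<in> X" for c
    unfolding \<Sigma>_def by (intro D.subspace_sum X) (use B(1) X in \<open>auto intro: D.subspace_scale\<close>)
  have \<Sigma>_0: "c b = 0" if "\<Sigma> c = 0" "b \<in> B" for c b
    using D.independentD[OF B(2) fin order_refl, of c b] that unfolding \<Sigma>_def by blast
  define sph where "sph c \<longleftrightarrow> (\<exists>b\<in>B. c b \<noteq> 0 \<and> v (c b) = 0)" for c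
  define C where "C = {c. \<forall>b\<in>B. c b \<in> val_ring v}"
  define S where "S = \<Sigma> ` {c \<in> C. sph c}"
  \<comment> \<open>The value \<open>None\<close> off the sphere extends f to all integral
    coordinate vectors. Local constancy survives because membership in the sphere depends only on
    the coordinates modulo the maximal ideal; this is the 1 in \<open>max n 1\<close> below.\<close>
  define g where "g c = (if sph c then Some (f (\<Sigma> c)) else None)" for c
  have i_diff: "i (a - b) = i a - i b" for a b
  proof -
    have add: "i (x + y) = i x + i y" for x y using i unfolding ring_embedding_def by blast
    show ?thesis using add[of "a - b" b] by simp
  qed
  have "finite (g ` C)"
    unfolding C_def
  proof (rule finite_image_locally_constant[OF fin])
    fix c assume c: "c \<in> {c. \<forall>b\<in>B. c b \<in> val_ring v}"
    have sph_eq: "sph c' \<longleftrightarrow> sph c"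
      if "\<forall>b\<in>B. c' b \<in> val_ring v" "\<forall>b\<in>B. c' b - c b \<in> val_ball v 1" for c'
    proof -
      have ideal: "(y \<noteq> 0 \<and> v y = 0) \<longleftrightarrow> y \<notin> val_ideal v" if "y \<in> val_ring v" for y
        using that unfolding val_ball_def by auto
      have "c' b \<in> val_ideal v \<longleftrightarrow> c b \<in> val_ideal v" if "b \<in> B" for b
        using val_ball_add[of "c' b - c b" 1 "c b"] val_ball_diff[of "c' b" 1 "c' b - c b"]
          \<open>\<forall>b\<in>B. c' b - c b \<in> val_ball v 1\<close> that by auto
      then show ?thesis unfolding sph_def using ideal c that by auto
    qed
    obtain n where n: "\<And>a. sph c \<Longrightarrow> (\<forall>b\<in>B. a b \<in> val_ball v n) \<Longrightarrow>
      \<Sigma> c + (\<Sum>b\<in>B. i (a b) * b) \<noteq> 0 \<Longrightarrow> f (\<Sigma> c + (\<Sum>b\<in>B. i (a b) * b)) = f (\<Sigma> c)"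
    proof (cases "sph c")
      case True
      then have "\<Sigma> c \<in> X - {0}" using \<Sigma>_X \<Sigma>_0[of c] unfolding sph_def by auto
      from f[OF this fin B(1)] that show ?thesis by blast
    qed (use that in blast)
    show "\<exists>n. \<forall>c'\<in>{c. \<forall>b\<in>B. c b \<in> val_ring v}. (\<forall>b\<in>B. c' b - c b \<in> val_ball v n) \<longrightarrow> g c' = g c"
    proof (intro exI[of _ "max n 1"] ballI impI)
      fix c' assume c': "c' \<in> {c. \<forall>b\<in>B. c b \<in> val_ring v}" and d: "\<forall>b\<in>B. c' b - c b \<in> val_ball v (max n 1)"
      have d1: "\<forall>b\<in>B. c' b - c b \<in> val_ball v 1" and dn: "\<forall>b\<in>B. c' b - c b \<in> val_ball v n"
        using d val_ball_mono[of 1 "max n 1" v] val_ball_mono[of n "max n 1" v] by auto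
      have s: "sph c' \<longleftrightarrow> sph c" using sph_eq c' d1 by auto
      have eq: "\<Sigma> c + (\<Sum>b\<in>B. i (c' b - c b) * b) = \<Sigma> c'"
        unfolding \<Sigma>_def by (simp add: i_diff left_diff_distrib sum_subtractf)
      have "f (\<Sigma> c') = f (\<Sigma> c)" if "sph c"
      proof -
        have "sph c'" using s that by simp
        then have "\<Sigma> c' \<noteq> 0" using \<Sigma>_0[of c'] unfolding sph_def by auto
        then show ?thesis using n[of "\<lambda>b. c' b - c b", OF that dn] unfolding eq by simp
      qed
      then show "g c' = g c" unfolding g_def using s by simp
    qed
  qed
  then have "finite (the ` g ` C)" by simp
  moreover have "f ` S \<subseteq> the ` g ` C"
  proof
    fix y assume "y \<in> f ` S"
    then obtain c where "c \<in> C" "sph c" "y = f (\<Sigma> c)" unfolding S_def by blast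
    then have "y = the (g c)" unfolding g_def by simp
    then show "y \<in> the ` g ` C" using \<open>c \<in> C\<close> by blast
  qed
  ultimately have fin_S: "finite (f ` S)" by (rule rev_finite_subset)
  have S_X: "S \<subseteq> X - {0}"
  proof
    fix s assume "s \<in> S"
    then obtain c where c: "sph c" "s = \<Sigma> c" unfolding S_def by blast
    then show "s \<in> X - {0}" using \<Sigma>_X \<Sigma>_0[of c] unfolding sph_def by auto
  qed
  have S_all: "\<exists>k. \<exists>s\<in>S. x = i (power_int \<omega> k) * s" if x: "x \<in> X - {0}" for x
  proof -
    have "x \<in> D.span B" using x B(3) by blast
    then obtain c where c: "x = \<Sigma> c" unfolding D.span_finite[OF fin] \<Sigma>_def by blast
    have "\<exists>b\<in>B. c b \<noteq> 0"
    proof (rule ccontr)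
      assume "\<not> ?thesis"
      then have "\<Sigma> c = 0" unfolding \<Sigma>_def using D.scale_zero_left by simp
      then show False using x c by simp
    qed
    define M where "M = (\<lambda>b. v (c b)) ` {b \<in> B. c b \<noteq> 0}"
    have M: "finite M" "M \<noteq> {}" using fin \<open>\<exists>b\<in>B. c b \<noteq> 0\<close> unfolding M_def by auto
    then have "Min M \<in> M" by (rule Min_in)
    then obtain b0 where b0: "b0 \<in> B" "c b0 \<noteq> 0" "v (c b0) = Min M" unfolding M_def by auto
    have v_le: "v (c b0) \<le> v (c b)" if "b \<in> B" "c b \<noteq> 0" for b
      unfolding b0(3) by (rule Min_le[OF M(1)]) (use that in \<open>auto simp: M_def\<close>)
    \<comment> \<open>The minimal valuation of the coordinates; dividing by \<omega>^k makes them
      all integral and the one at \<open>b0\<close> a unit.\<close>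
    define k where "k = v (c b0)"
    define a where "a = power_int \<omega> k"
    have a: "a \<noteq> 0" "v a = k" using \<omega> v_power_int[of \<omega> k] by (auto simp: a_def)
    define c' where "c' b = inverse a * c b" for b
    have v_c': "v (c' b) = v (c b) - k" if "c b \<noteq> 0" for b
      unfolding c'_def using v_mult[of "inverse a" "c b"] a v_inverse[of a] that by simp
    have "c' b \<in> val_ring v" if "b \<in> B" for b
      using v_c'[of b] v_le[OF that] by (cases "c b = 0") (simp_all add: val_ball_def c'_def k_def)
    then have "c' \<in> C" unfolding C_def by blast
    moreover have "sph c'" unfolding sph_def using b0 v_c'[OF b0(2)] a
      by (intro bexI[of _ b0]) (auto simp: c'_def k_def)
    ultimately have "\<Sigma> c' \<in> S" unfolding S_def by blast
    moreover have "x = i a * \<Sigma> c'"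
    proof -
      have eq: "i a * (i (c' b) * b) = i (c b) * b" for b
        using D.scale_scale[of a "c' b" b] a by (simp add: c'_def flip: mult.assoc[of a])
      show ?thesis unfolding c \<Sigma>_def by (simp only: sum_distrib_left eq)
    qed
    ultimately show ?thesis unfolding a_def by blast
  qed
  from S_X fin_S S_all show thesis by (rule that)
qed

end

section \<open>Division rings with an anticommuting pair\<close>

text \<open>As \<kappa>^2 is central, conjugation by \<kappa> is an involution. Its eigenspaces for
  1 and -1 are \<Delta> and w \<Delta>, and since 2 is invertible D is their direct sum: a right
  \<Delta>-plane with basis 1, w.\<close>

locale anticommuting_pair =
  fixes \<kappa> w :: "'d::division_ring" and \<Delta> :: "'d set"
  assumes mem_\<Delta>: "z \<in> \<Delta> \<longleftrightarrow> z * \<kappa> = \<kappa> * z"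
    and \<kappa>_sq: "\<kappa> * \<kappa> * x = x * (\<kappa> * \<kappa>)"
    and anti: "w * \<kappa> = - (\<kappa> * w)"
    and w0: "w \<noteq> 0" and \<kappa>0: "\<kappa> \<noteq> 0" and two: "(2::'d) \<noteq> 0"
begin

definition half :: 'd where "half = inverse 2"

lemma half_2: "half * 2 = 1" "2 * half = 1"
  unfolding half_def by (rule left_inverse right_inverse, rule two)+

lemma half_add: "half * x + half * x = x"
proof -
  have "half * x + half * x = half * 2 * x" by (simp only: mult_2_right distrib_right)
  then show ?thesis by (simp only: half_2 mult_1_left)
qed

lemma half_commute: "half * x = x * half"
proof -
  have "half * x = half * (x * 2) * half" by (simp only: mult.assoc half_2 mult_1_right)
  also have "x * 2 = 2 * x" by (simp only: mult_2 mult_2_right)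
  also have "half * (2 * x) * half = x * half"
    by (simp only: mult.assoc[symmetric] half_2 mult_1_left)
  finally show ?thesis .
qed

lemma conj_\<kappa>: "\<kappa> * \<kappa> * y * inverse \<kappa> = y * \<kappa>"
proof -
  have "\<kappa> * \<kappa> * y * inverse \<kappa> = y * \<kappa> * (\<kappa> * inverse \<kappa>)" unfolding \<kappa>_sq by (simp only: mult.assoc)
  then show ?thesis using \<kappa>0 by simp
qed

text \<open>The coordinates with respect to the basis 1, w: y is projected to the eigenspaces of
  conjugation by \<kappa>, and the component for -1 is divided by w from the left.\<close>

definition pr1 :: "'d \<Rightarrow> 'd" where "pr1 y = half * (y + \<kappa> * y * inverse \<kappa>)"
definition pr2 :: "'d \<Rightarrow> 'd" where "pr2 y = inverse w * (half * (y - \<kappa> * y * inverse \<kappa>))"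

lemma \<Delta>_closed:
  shows \<Delta>_0: "0 \<in> \<Delta>" and \<Delta>_1: "1 \<in> \<Delta>"
    and \<Delta>_add: "a \<in> \<Delta> \<Longrightarrow> b \<in> \<Delta> \<Longrightarrow> a + b \<in> \<Delta>"
    and \<Delta>_minus: "a \<in> \<Delta> \<Longrightarrow> - a \<in> \<Delta>"
    and \<Delta>_diff: "a \<in> \<Delta> \<Longrightarrow> b \<in> \<Delta> \<Longrightarrow> a - b \<in> \<Delta>"
    and \<Delta>_mult: "a \<in> \<Delta> \<Longrightarrow> b \<in> \<Delta> \<Longrightarrow> a * b \<in> \<Delta>"
    and \<Delta>_inverse: "a \<in> \<Delta> \<Longrightarrow> inverse a \<in> \<Delta>"
proof -
  show "a * b \<in> \<Delta>" if "a \<in> \<Delta>" "b \<in> \<Delta>"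
    using that unfolding mem_\<Delta> by (metis mult.assoc)
  show "inverse a \<in> \<Delta>" if "a \<in> \<Delta>"
  proof (cases "a = 0")
    case False
    have "inverse a * \<kappa> = inverse a * (\<kappa> * a) * inverse a" using False by (simp add: mult.assoc)
    also have "\<dots> = inverse a * (a * \<kappa>) * inverse a" using that by (simp add: mem_\<Delta>)
    also have "\<dots> = \<kappa> * inverse a" using False by (simp add: mult.assoc[symmetric])
    finally show ?thesis by (simp add: mem_\<Delta>)
  qed (simp add: mem_\<Delta>)
qed (simp_all add: mem_\<Delta> distrib_left distrib_right left_diff_distrib right_diff_distrib)

lemma anti_inverse: "inverse w * \<kappa> = - (\<kappa> * inverse w)"
proof -
  have "inverse w * \<kappa> = inverse w * (\<kappa> * w) * inverse w" using w0 by (simp add: mult.assoc)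
  also have "\<dots> = - (inverse w * (w * \<kappa>) * inverse w)" by (simp add: anti)
  finally show ?thesis using w0 by (simp add: mult.assoc[symmetric])
qed

text \<open>Such a p both commutes and anticommutes with \<kappa>, so 2 \<kappa> p = 0. This makes
  the sum of \<Delta> and w \<Delta> direct.\<close>

lemma w_mult_eq: 
  assumes "p \<in> \<Delta>" "q \<in> \<Delta>" "p = w * q"
  shows "p = 0"
proof -
  have "p * \<kappa> = w * \<kappa> * q" using assms by (simp add: mem_\<Delta> mult.assoc)
  also have "\<dots> = - (\<kappa> * p)" using assms by (simp add: anti mult.assoc)
  finally have "\<kappa> * p + \<kappa> * p = 0" using assms(1) by (metis mem_\<Delta> add.right_inverse)
  then have "2 * (\<kappa> * p) = 0" by (simp only: mult_2)
  then show ?thesis using two \<kappa>0 by simp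
qed

lemma w_notin_\<Delta>: "w \<notin> \<Delta>"
  using w_mult_eq[of w 1] w0 \<Delta>_1 by auto

lemma pr1_closed: "pr1 y \<in> \<Delta>"
proof -
  let ?z = "y + \<kappa> * y * inverse \<kappa>"
  have "\<kappa> * ?z = \<kappa> * y + (\<kappa> * \<kappa> * y) * inverse \<kappa>" by (simp add: distrib_left mult.assoc)
  also have "\<dots> = ?z * \<kappa>" unfolding conj_\<kappa> using \<kappa>0 by (simp add: distrib_right mult.assoc add.commute)
  finally have "half * (\<kappa> * ?z) = half * (?z * \<kappa>)" by simp
  then show ?thesis unfolding mem_\<Delta> pr1_def
    by (simp only: mult.assoc[symmetric] half_commute[of \<kappa>, symmetric])
qed

lemma pr2_closed: "pr2 y \<in> \<Delta>"
proof -
  let ?z = "half * (y - \<kappa> * y * inverse \<kappa>)"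
  have "\<kappa> * (y - \<kappa> * y * inverse \<kappa>) = \<kappa> * y - (\<kappa> * \<kappa> * y) * inverse \<kappa>"
    by (simp add: right_diff_distrib mult.assoc)
  also have "\<dots> = - ((y - \<kappa> * y * inverse \<kappa>) * \<kappa>)"
    unfolding conj_\<kappa> using \<kappa>0 by (simp add: left_diff_distrib mult.assoc)
  finally have "half * (\<kappa> * (y - \<kappa> * y * inverse \<kappa>)) = - (?z * \<kappa>)" by (simp add: mult.assoc)
  then have "\<kappa> * ?z = - (?z * \<kappa>)"
    by (simp only: mult.assoc[symmetric] half_commute[of \<kappa>, symmetric])
  then have "inverse w * (?z * \<kappa>) = inverse w * (- (\<kappa> * ?z))" by simp
  also have "\<dots> = - (inverse w * \<kappa>) * ?z" by (simp add: mult.assoc)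
  also have "\<dots> = \<kappa> * (inverse w * ?z)" by (simp only: anti_inverse minus_minus mult.assoc)
  finally show ?thesis unfolding mem_\<Delta> pr2_def by (simp only: mult.assoc)
qed

lemma pr_sum: "pr1 y + w * pr2 y = y"
proof -
  have "w * pr2 y = half * (y - \<kappa> * y * inverse \<kappa>)"
    using w0 by (simp add: pr2_def mult.assoc[symmetric])
  then have "pr1 y + w * pr2 y = half * y + half * y"
    by (simp add: pr1_def distrib_left right_diff_distrib)
  then show ?thesis by (simp add: half_add)
qed

lemma pr_unique:
  assumes "p \<in> \<Delta>" "q \<in> \<Delta>" "p + w * q = y"
  shows "pr1 y = p" "pr2 y = q"
proof -
  have "pr1 y + w * pr2 y = p + w * q" using assms(3) pr_sum by simp
  then have eq: "pr1 y - p = w * (q - pr2 y)" by (simp add: algebra_simps)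
  then have 0: "pr1 y - p = 0"
    using assms(1,2) by (intro w_mult_eq[OF _ _ eq] \<Delta>_diff pr1_closed pr2_closed)
  then show "pr1 y = p" by simp
  show "pr2 y = q" using eq w0 unfolding 0 by simp
qed

lemma pr_\<Delta>: "x \<in> \<Delta> \<Longrightarrow> pr1 x = x" "x \<in> \<Delta> \<Longrightarrow> pr2 x = 0"
  using pr_unique[of x 0 x] \<Delta>_0 by auto

lemma pr_w: "x \<in> \<Delta> \<Longrightarrow> pr1 (w * x) = 0" "x \<in> \<Delta> \<Longrightarrow> pr2 (w * x) = x"
  using pr_unique[of 0 x "w * x"] \<Delta>_0 by auto

lemma pr_add: "pr1 (x + y) = pr1 x + pr1 y" "pr2 (x + y) = pr2 x + pr2 y"
proof -
  have "(pr1 x + pr1 y) + w * (pr2 x + pr2 y) = (pr1 x + w * pr2 x) + (pr1 y + w * pr2 y)"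
    by (simp add: distrib_left)
  then have "(pr1 x + pr1 y) + w * (pr2 x + pr2 y) = x + y" by (simp only: pr_sum)
  from pr_unique[OF _ _ this] show "pr1 (x + y) = pr1 x + pr1 y" "pr2 (x + y) = pr2 x + pr2 y"
    by (simp_all add: \<Delta>_add pr1_closed pr2_closed)
qed

lemma pr_mult: assumes "c \<in> \<Delta>"
  shows "pr1 (y * c) = pr1 y * c" "pr2 (y * c) = pr2 y * c"
proof -
  have "pr1 y * c + w * (pr2 y * c) = (pr1 y + w * pr2 y) * c"
    by (simp add: distrib_right mult.assoc)
  then have "pr1 y * c + w * (pr2 y * c) = y * c" by (simp only: pr_sum)
  from pr_unique[OF _ _ this] show "pr1 (y * c) = pr1 y * c" "pr2 (y * c) = pr2 y * c"
    using assms by (simp_all add: \<Delta>_mult pr1_closed pr2_closed)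
qed

text \<open>The automorphism of \<Delta> given by s w = w \<theta>(s): left multiplication by s is
  diag(s, \<theta> s) in the basis 1, w.\<close>

definition \<theta> :: "'d \<Rightarrow> 'd" where "\<theta> s = inverse w * s * w"

lemma \<theta>_closed: assumes "s \<in> \<Delta>" shows "\<theta> s \<in> \<Delta>" "w * s * inverse w \<in> \<Delta>"
proof -
  have "inverse w * s * w * \<kappa> = - (inverse w * (s * \<kappa>) * w)" by (simp add: mult.assoc anti)
  also have "\<dots> = - (inverse w * \<kappa>) * s * w" using assms by (simp add: mem_\<Delta> mult.assoc)
  also have "\<dots> = \<kappa> * (inverse w * s * w)" by (simp only: anti_inverse minus_minus mult.assoc)
  finally show "\<theta> s \<in> \<Delta>" by (simp add: mem_\<Delta> \<theta>_def)
  have "w * s * inverse w * \<kappa> = - (w * (s * \<kappa>) * inverse w)" by (simp add: mult.assoc anti_inverse)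
  also have "\<dots> = - (w * \<kappa>) * s * inverse w" using assms by (simp add: mem_\<Delta> mult.assoc)
  also have "\<dots> = \<kappa> * (w * s * inverse w)" by (simp only: anti minus_minus mult.assoc)
  finally show "w * s * inverse w \<in> \<Delta>" by (simp add: mem_\<Delta>)
qed

lemma pr_left_mult: assumes "s \<in> \<Delta>"
  shows "pr1 (s * y) = s * pr1 y" "pr2 (s * y) = \<theta> s * pr2 y"
proof -
  have "s * pr1 y + w * (\<theta> s * pr2 y) = s * (pr1 y + w * pr2 y)"
    using w0 by (simp add: \<theta>_def distrib_left mult.assoc[symmetric])
  then have "s * pr1 y + w * (\<theta> s * pr2 y) = s * y" by (simp only: pr_sum)
  from pr_unique[OF _ _ this] show "pr1 (s * y) = s * pr1 y" "pr2 (s * y) = \<theta> s * pr2 y"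
    using assms \<theta>_closed(1) by (simp_all add: \<Delta>_mult pr1_closed pr2_closed)
qed

text \<open>The matrix \<open>diag(1, b)\<close> with respect to the \<open>\<Delta>\<close>-basis \<open>1, w\<close>.\<close>

definition diag :: "'d \<Rightarrow> 'd \<Rightarrow> 'd" where "diag b y = pr1 y + w * (b * pr2 y)"

lemma pr_diag: "b \<in> \<Delta> \<Longrightarrow> pr1 (diag b y) = pr1 y" "b \<in> \<Delta> \<Longrightarrow> pr2 (diag b y) = b * pr2 y"
  using pr_unique[of "pr1 y" "b * pr2 y" "diag b y"] \<Delta>_mult pr1_closed pr2_closed
  by (auto simp: diag_def)

lemma diag_mult: "c \<in> \<Delta> \<Longrightarrow> diag (b * c) = diag b \<circ> diag c"
  unfolding fun_eq_iff o_apply by (simp add: diag_def[of b] diag_def[of "b * c"] pr_diag mult.assoc)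

lemma diag_1: "diag 1 = id"
  unfolding fun_eq_iff by (simp add: diag_def pr_sum)

lemma diag_\<Delta>: "x \<in> \<Delta> \<Longrightarrow> diag b x = x"
  by (simp add: diag_def pr_\<Delta>)

lemma diag_in_End: "diag b \<in> carrier (End_ring \<Delta>)"
  by (simp add: End_ring_def diag_def pr_add pr_mult distrib_left distrib_right mult.assoc add_ac)

lemma lmul_in_End: "lmul x \<in> carrier (End_ring \<Delta>)"
  by (simp add: End_ring_def lmul_def distrib_left mult.assoc)

text \<open>All factors are diagonal in the basis 1, w, \<open>lmul s\<close> being diag(s, \<theta>
  s), so only the second entry is conjugated.\<close>

lemma lmul_diag:
  assumes "s \<in> \<Delta> - {0}" "b \<in> \<Delta>"
  shows "lmul s \<circ> diag b = diag (\<theta> s * b * inverse (\<theta> s)) \<circ> lmul s"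
proof
  fix y
  have "\<theta> s \<noteq> 0" using assms w0 by (simp add: \<theta>_def)
  have "s * (w * z) = w * (\<theta> s * z)" for z
    using w0 by (simp add: \<theta>_def mult.assoc[symmetric])
  then have "s * diag b y = s * pr1 y + w * (\<theta> s * (b * pr2 y))"
    by (simp add: diag_def distrib_left)
  also have "\<dots> = diag (\<theta> s * b * inverse (\<theta> s)) (s * y)"
    using \<open>\<theta> s \<noteq> 0\<close> assms(1) by (simp add: diag_def pr_left_mult mult.assoc)
      (simp add: mult.assoc[symmetric])
  finally show "(lmul s \<circ> diag b) y = (diag (\<theta> s * b * inverse (\<theta> s)) \<circ> lmul s) y"
    by (simp add: lmul_def)
qed

text \<open>With respect to \<open>1, w\<close> such a \<open>p\<close> is upper triangular with upper left entry \<open>1\<close>.\<close>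

lemma fixes_1_decomposition:
  assumes p: "p \<in> carrier (End_ring \<Delta>)" "inj p" "p 1 = 1"
  obtains b where "b \<in> \<Delta> - {0}" "\<And>y. y \<in> \<Delta> \<Longrightarrow> p (diag (inverse b) y) = y"
    "\<And>y. p (diag (inverse b) y) - y \<in> \<Delta>"
proof -
  have p_add: "p (x + y) = p x + p y" and p_mult: "c \<in> \<Delta> \<Longrightarrow> p (x * c) = p x * c" for x y c
    using p(1) by (simp_all add: End_ring_def)
  have p_\<Delta>: "p y = y" if "y \<in> \<Delta>" for y using p_mult[OF that, of 1] p(3) by simp
  define a b where "a = pr1 (p w)" and "b = pr2 (p w)"
  have ab: "a \<in> \<Delta>" "b \<in> \<Delta>" "p w = a + w * b"
    unfolding a_def b_def by (simp_all add: pr1_closed pr2_closed pr_sum)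
  \<comment> \<open>If b = 0, then p maps w to a, which is also the image of a in \<Delta>; as w is
    not in \<Delta>, this contradicts injectivity.\<close>
  have "b \<noteq> 0"
  proof
    assume "b = 0"
    then have "p w = p a" using ab p_\<Delta>[OF ab(1)] by simp
    then show False using p(2) w_notin_\<Delta> ab(1) by (auto dest: injD)
  qed
  have ib: "inverse b \<in> \<Delta>" by (rule \<Delta>_inverse[OF ab(2)])
  have "p (diag (inverse b) y) - y = a * (inverse b * pr2 y)" for y
  proof -
    have q: "inverse b * pr2 y \<in> \<Delta>" by (intro \<Delta>_mult ib pr2_closed)
    have "p (diag (inverse b) y) = pr1 y + (a + w * b) * (inverse b * pr2 y)"
      by (simp only: diag_def p_add p_mult[OF q] p_\<Delta>[OF pr1_closed] ab(3))
    also have "\<dots> = a * (inverse b * pr2 y) + (pr1 y + w * (b * inverse b * pr2 y))"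
      by (simp add: distrib_right mult.assoc add_ac)
    also have "\<dots> = a * (inverse b * pr2 y) + y" using \<open>b \<noteq> 0\<close> by (simp add: pr_sum)
    finally show ?thesis by simp
  qed
  then show thesis
    using that[of b] ab \<open>b \<noteq> 0\<close> ib p_\<Delta> by (simp add: \<Delta>_mult pr2_closed diag_\<Delta>)
qed

end

section \<open>Quadratic extensions inside the division algebra\<close>

lemma ring_embedding_hom:
  assumes "ring_embedding f"
  shows "f 1 = 1" "f (x + y) = f x + f y" "f (x * y) = f x * f y" "f 0 = 0" "f (- x) = - f x"
    "f (x - y) = f x - f y" "f x = f y \<longleftrightarrow> x = y" "f x = 0 \<longleftrightarrow> x = 0"
proof -
  show 1: "f 1 = 1" and add: "\<And>x y. f (x + y) = f x + f y" and "f (x * y) = f x * f y"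
    and inj: "\<And>x y. f x = f y \<longleftrightarrow> x = y"
    using assms unfolding ring_embedding_def inj_def by blast+
  show 0: "f 0 = 0" using add[of 0 0] by simp
  show minus: "f (- x) = - f x" for x using add[of x "- x"] 0 by (simp add: eq_neg_iff_add_eq_0 add.commute)
  show "f (x - y) = f x - f y" using add[of x "- y"] minus[of y] by simp
  show "f x = 0 \<longleftrightarrow> x = 0" using inj[of x 0] 0 by simp
qed

text \<open>If 2 = 0 in F, then the residue characteristic is 2. Comparing both ramification
  conditions at a uniformizer shows that the tame index is 2 as well, which contradicts
  tameness.\<close>

lemma tame_two_nonzero:
  fixes vF :: "'f::field \<Rightarrow> int"
  assumes "nonarch_local_field vF" "dim_over j = 2" "totally_ramified j vF vK" "tamely_ramified j vF vK"
  shows "(2::'f) \<noteq> 0"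
proof
  interpret local_field vF using assms(1) by (rule local_field.intro)
  assume 0: "(2::'f) = 0"
  obtain e where "has_ramification_index j vF vK e"
    and e2: "\<forall>p::nat. prime p \<and> of_nat p \<in> val_ideal vF \<longrightarrow> \<not> p dvd e"
    using assms(4) unfolding tamely_ramified_def by blast
  then have e1: "vK (j a) = int e * vF a" if "a \<noteq> 0" for a
    using that unfolding has_ramification_index_def by simp
  obtain \<omega> where \<omega>: "\<omega> \<noteq> 0" "vF \<omega> = 1" using uniformizer by blast
  have "vK (j \<omega>) = 2"
    using assms(2,3) \<omega> unfolding totally_ramified_def has_ramification_index_def by simp
  then have "e = 2" using e1[OF \<omega>(1)] \<omega>(2) by simp
  moreover have "of_nat 2 \<in> val_ideal vF" using 0 by (simp add: val_ball_def)
  ultimately show False using e2[rule_format, of 2] by simp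
qed

text \<open>Completing the square: if x^2 = a + b x, then k0 = 2 x - b has square 4 a + b^2, and x
  is recovered from k0 because 2 is invertible.\<close>

lemma quadratic_generator:
  fixes j :: "'f::field \<Rightarrow> 'k::field"
  assumes "quadratic_extension j" "(2::'f) \<noteq> 0"
  obtains k0 c where "k0 \<notin> range j" "k0 * k0 = j c" "\<And>y. \<exists>p q. y = j p + j q * k0"
proof -
  have j: "ring_embedding j" "dim_over j = 2" using assms(1) by (simp_all add: quadratic_extension_def)
  note hom = ring_embedding_hom[OF j(1)]
  interpret K: vector_space "\<lambda>a x. j a * x" by (rule vector_space_embedding[OF j(1)])
  obtain B where B: "finite B" "card B = 2" "K.span B = UNIV"
    using dim_over_basis[OF j(1)] j(2) by auto
  have dep: "K.dependent S" if "finite S" "card S > 2" for S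
    using K.independent_span_bound[OF B(1), of S] that B by auto
  have span1: "K.span {1} = range j" unfolding K.span_singleton by auto
  have "range j \<noteq> UNIV"
  proof
    assume "range j = UNIV"
    then have "K.dim UNIV \<le> card {1::'k}" by (intro K.dim_le_card) (simp_all add: span1)
    then show False using j(2) unfolding dim_over_def by simp
  qed
  then obtain x where x: "x \<notin> range j" by blast
  have x1: "x \<noteq> 1" using x hom(1) by (metis rangeI)
  have "K.independent {1}" by (simp add: K.dependent_single)
  then have ind: "K.independent {x, 1}"
    by (rule K.independent_insertI[rotated]) (use x span1 in simp)
  have "y \<in> K.span {x, 1}" for y
  proof (rule ccontr)
    assume y: "y \<notin> K.span {x, 1}"
    then have "K.independent {y, x, 1}" using ind by (rule K.independent_insertI)
    moreover have "y \<notin> {x, 1}" using y K.span_base by blast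
    ultimately show False using dep[of "{y, x, 1}"] x1 by simp
  qed
  then have "\<exists>q. y - j q * x \<in> range j" for y
    unfolding K.span_insert[of x] span1 by auto
  then have comb: "\<exists>p q. y = j p + j q * x" for y
    by (metis diff_eq_eq imageE)
  obtain a b where ab: "x * x = j a + j b * x" using comb by blast
  define k0 where "k0 = 2 * x - j b"
  have j2: "j 2 = 2" using hom(1) hom(2)[of 1 1] by simp
  have half: "j (inverse 2) * 2 = 1" using hom(3)[of "inverse 2" 2] assms(2) by (simp add: j2 hom(1))
  have x_k0: "x = j (inverse 2) * (k0 + j b)"
    using half by (simp add: k0_def mult.assoc[symmetric])
  show thesis
  proof (rule that[of k0 "4 * a + b * b"])
    show "k0 \<notin> range j"
    proof
      assume "k0 \<in> range j"
      then obtain t where "k0 = j t" by blast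
      then have "x = j (inverse 2 * (t + b))" using x_k0 by (simp only: hom)
      then show False using x by blast
    qed
    have "k0 * k0 = 4 * (x * x - j b * x) + j b * j b"
      by (simp add: k0_def algebra_simps)
    also have "\<dots> = j (4 * a + b * b)"
      using hom(3)[of 2 2] by (simp add: ab hom(2,3) j2)
    finally show "k0 * k0 = j (4 * a + b * b)" .
    fix y
    obtain p q where "y = j p + j q * x" using comb by blast
    then have "y = j (p + q * inverse 2 * b) + j (q * inverse 2) * k0"
      by (subst (asm) x_k0) (simp only: hom ring_distribs mult.assoc add_ac)
    then show "\<exists>p q. y = j p + j q * k0" by blast
  qed
qed

text \<open>The generator \<kappa> of K has central square but is not central. Hence some commutator
  w = \<kappa> x - x \<kappa> is nonzero, and it anticommutes with \<kappa>. Commuting with \<kappa>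
  means commuting with K, as K = F + F \<kappa>.\<close>

lemma exists_anticommuting_pair:
  fixes i :: "'f::field \<Rightarrow> 'd::division_ring" and \<iota> :: "'k::field \<Rightarrow> 'd"
  assumes j: "quadratic_extension j" and two: "(2::'f) \<noteq> 0"
    and i: "ring_embedding i" "range i = {z. \<forall>x. z * x = x * z}"
    and \<iota>: "ring_embedding \<iota>" "\<iota> \<circ> j = i"
  obtains \<kappa> w where "anticommuting_pair \<kappa> w (centralizer (range \<iota>))"
proof -
  obtain k0 c where k0: "k0 \<notin> range j" "k0 * k0 = j c" "\<And>y. \<exists>p q. y = j p + j q * k0"
    using quadratic_generator[OF j two] by blast
  note hom = ring_embedding_hom[OF \<iota>(1)] and homi = ring_embedding_hom[OF i(1)]
  have \<iota>j: "\<iota> (j a) = i a" for a using \<iota>(2) by (auto simp: fun_eq_iff)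
  have central: "i a * x = x * i a" for a x using i(2) by blast
  define \<kappa> where "\<kappa> = \<iota> k0"
  have sq: "\<kappa> * \<kappa> = i c" unfolding \<kappa>_def by (metis hom(3) k0(2) \<iota>j)
  have "\<kappa> \<notin> range i"
  proof
    assume "\<kappa> \<in> range i"
    then obtain a where "\<iota> k0 = \<iota> (j a)" unfolding \<kappa>_def \<iota>j by blast
    then show False using k0(1) hom(7) by blast
  qed
  then obtain x where x: "\<kappa> * x \<noteq> x * \<kappa>" unfolding i(2) by blast
  define w where "w = \<kappa> * x - x * \<kappa>"
  have "anticommuting_pair \<kappa> w (centralizer (range \<iota>))"
  proof
    fix z
    show "z \<in> centralizer (range \<iota>) \<longleftrightarrow> z * \<kappa> = \<kappa> * z"
    proof
      assume "z \<in> centralizer (range \<iota>)"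
      then show "z * \<kappa> = \<kappa> * z" unfolding centralizer_def \<kappa>_def by blast
    next
      assume z: "z * \<kappa> = \<kappa> * z"
      show "z \<in> centralizer (range \<iota>)"
        unfolding centralizer_def
      proof (intro CollectI ballI)
        fix s assume "s \<in> range \<iota>"
        then obtain p q where "s = \<iota> (j p + j q * k0)" using k0(3) by (metis imageE)
        then have s: "s = i p + i q * \<kappa>" by (simp add: hom \<iota>j \<kappa>_def)
        have "z * (i q * \<kappa>) = i q * \<kappa> * z" by (metis central mult.assoc z)
        then show "z * s = s * z" unfolding s by (simp add: distrib_left distrib_right central)
      qed
    qed
  next
    show "\<kappa> * \<kappa> * x = x * (\<kappa> * \<kappa>)" for x unfolding sq by (rule central)
    have "\<kappa> * (\<kappa> * x) = x * (\<kappa> * \<kappa>)" using central[of c x] by (simp add: sq flip: mult.assoc)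
    then show "w * \<kappa> = - (\<kappa> * w)"
      by (simp add: w_def left_diff_distrib right_diff_distrib mult.assoc)
    show "w \<noteq> 0" using x by (simp add: w_def)
    show "\<kappa> \<noteq> 0" using x by auto
    have "i 2 = 2" using homi(1) homi(2)[of 1 1] by simp
    then show "(2::'d) \<noteq> 0" using homi(8)[of 2] two by simp
  qed
  then show thesis by (rule that)
qed

section \<open>Forms invariant under the division algebra\<close>

locale DK_representation =
  anticommuting_pair \<kappa> w "centralizer (range \<iota>)" + local_field vF
  for \<kappa> w :: "'d::division_ring" and \<iota> :: "'k::field \<Rightarrow> 'd" and vF :: "'f::field \<Rightarrow> int" +
  fixes vK :: "'k \<Rightarrow> int" and j :: "'f \<Rightarrow> 'k" and i :: "'f \<Rightarrow> 'd"
    and sV :: "complex \<Rightarrow> 'v::ab_group_add \<Rightarrow> 'v" and \<pi> :: "('d \<Rightarrow> 'd) \<Rightarrow> 'v \<Rightarrow> 'v"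
  assumes i: "ring_embedding i" and center: "range i = {z. \<forall>x. z * x = x * z}"
    and finite_dim: "dim_over i > 0"
    and \<iota>: "ring_embedding \<iota>" and \<iota>_j: "\<iota> \<circ> j = i"
    and vK_j: "\<And>a. a \<noteq> 0 \<Longrightarrow> j a \<noteq> 0 \<Longrightarrow> vK (j a) = 2 * vF a"
    and smooth: "smooth_representation (DK_group \<iota>) (DK_topology vK \<iota>) sV \<pi>"
    and irreducible: "irreducible_representation (DK_group \<iota>) sV \<pi>"
    and not_cuspidal: "\<not> cuspidal \<iota> sV \<pi>"
begin

section \<open>The group G and the operators of \<pi>\<close>

abbreviation "\<Delta> \<equiv> centralizer (range \<iota>)"
abbreviation "G \<equiv> DK_group \<iota>"

sublocale V: vector_space sV
  using smooth unfolding smooth_representation_def by blast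

sublocale G: group G
  by (rule group_DK_group)

lemmas i_hom = ring_embedding_hom[OF i] and \<iota>_hom = ring_embedding_hom[OF \<iota>]

lemma \<iota>_j': "\<iota> (j a) = i a"
  using \<iota>_j by (auto simp: fun_eq_iff)

lemma i_central: "i a * x = x * i a"
  using center by blast

lemma i_\<Delta>: "i a \<in> \<Delta>"
  by (simp add: mem_\<Delta> i_central)

lemma mem_G: "g \<in> carrier G \<longleftrightarrow> g \<in> carrier (End_ring \<Delta>) \<and>
    (\<exists>h\<in>carrier (End_ring \<Delta>). h \<circ> g = id \<and> g \<circ> h = id)"
  by (auto simp: DK_group_def DK_algebra_def units_of_def Units_def End_ring_def)

lemma G_mult: "g \<otimes>\<^bsub>G\<^esub> h = g \<circ> h" and G_one: "\<one>\<^bsub>G\<^esub> = id"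
  by (simp_all add: DK_group_def DK_algebra_def units_of_def End_ring_def)

lemma G_comp: "g \<in> carrier G \<Longrightarrow> h \<in> carrier G \<Longrightarrow> g \<circ> h \<in> carrier G"
  using G.m_closed[of g h] by (simp add: G_mult)

lemma G_inv: "g \<in> carrier G \<Longrightarrow> inv\<^bsub>G\<^esub> g \<circ> g = id" "g \<in> carrier G \<Longrightarrow> g \<circ> inv\<^bsub>G\<^esub> g = id"
  using G.l_inv[of g] G.r_inv[of g] by (simp_all add: G_mult G_one)

lemma G_inv_apply: "g \<in> carrier G \<Longrightarrow> (inv\<^bsub>G\<^esub> g) (g y) = y" "g \<in> carrier G \<Longrightarrow> g ((inv\<^bsub>G\<^esub> g) y) = y"
  using G_inv[of g] by (metis o_apply id_apply)+

lemma G_linear: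
  assumes "g \<in> carrier G"
  shows "g (x + y) = g x + g y" "g (x - y) = g x - g y" "c \<in> \<Delta> \<Longrightarrow> g (x * c) = g x * c"
proof -
  show add: "g (x + y) = g x + g y" for x y using assms by (simp add: mem_G End_ring_def)
  show "g (x - y) = g x - g y" using add[of "x - y" y] by simp
  show "c \<in> \<Delta> \<Longrightarrow> g (x * c) = g x * c" using assms by (simp add: mem_G End_ring_def)
qed

lemma lmul_G: "x \<noteq> 0 \<Longrightarrow> lmul x \<in> carrier G"
  using subgroup.subset[OF D_units_subgroup[of \<iota>]] unfolding D_units_def by blast

lemma lmul_mult: "lmul (x * y) = lmul x \<circ> lmul y"
  by (simp add: lmul_def fun_eq_iff mult.assoc)

lemma diag_G: assumes "b \<in> \<Delta> - {0}" shows "diag b \<in> carrier G"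
proof -
  have b: "b \<in> \<Delta>" "inverse b \<in> \<Delta>" "b \<noteq> 0" using assms \<Delta>_inverse by auto
  have "diag (inverse b) \<circ> diag b = id" "diag b \<circ> diag (inverse b) = id"
    using b by (simp_all flip: diag_mult add: diag_1)
  then show ?thesis unfolding mem_G using diag_in_End by blast
qed

lemma \<pi>_id: "\<pi> id x = x"
  using smooth by (simp add: smooth_representation_def G_one)

lemma \<pi>_comp: "g \<in> carrier G \<Longrightarrow> h \<in> carrier G \<Longrightarrow> \<pi> (g \<circ> h) x = \<pi> g (\<pi> h x)"
  using smooth by (simp add: smooth_representation_def G_mult)

lemma \<pi>_linear: "g \<in> carrier G \<Longrightarrow> Vector_Spaces.linear sV sV (\<pi> g)"
  using smooth by (simp add: smooth_representation_def)

lemma \<pi>_hom: assumes "g \<in> carrier G"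
  shows "\<pi> g (x + y) = \<pi> g x + \<pi> g y" "\<pi> g (x - y) = \<pi> g x - \<pi> g y"
    "\<pi> g (sV c x) = sV c (\<pi> g x)" "\<pi> g 0 = 0" "\<pi> g (sum f I) = (\<Sum>t\<in>I. \<pi> g (f t))"
proof -
  interpret Vector_Spaces.linear sV sV "\<pi> g" by (rule \<pi>_linear[OF assms])
  show "\<pi> g (x + y) = \<pi> g x + \<pi> g y" "\<pi> g (x - y) = \<pi> g x - \<pi> g y"
    "\<pi> g (sV c x) = sV c (\<pi> g x)" "\<pi> g 0 = 0" "\<pi> g (sum f I) = (\<Sum>t\<in>I. \<pi> g (f t))"
    by (rule add diff scale zero sum)+
qed

lemma \<pi>_inv: "g \<in> carrier G \<Longrightarrow> \<pi> (inv\<^bsub>G\<^esub> g) (\<pi> g x) = x" "g \<in> carrier G \<Longrightarrow> \<pi> g (\<pi> (inv\<^bsub>G\<^esub> g) x) = x"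
  using \<pi>_comp[of "inv\<^bsub>G\<^esub> g" g x] \<pi>_comp[of g "inv\<^bsub>G\<^esub> g" x] by (simp_all add: G_inv \<pi>_id)


subsection \<open>Finiteness modulo scalars\<close>

text \<open>Smoothness in coordinates: the stabilizer of x is the trace on G of an open set of
  endomorphisms around \<open>id\<close>, and \<open>vs_topology\<close> tests openness along any
  finite set of directions S.\<close>

lemma stabilizer_neighbourhood:
  assumes S: "finite S" "S \<subseteq> carrier (End_ring \<Delta>)"
  shows "\<exists>n. \<forall>c. (\<forall>s\<in>S. c s \<in> val_ball vK n) \<longrightarrow> id + (\<Sum>s\<in>S. K_scale \<iota> (c s) s) \<in> carrier G \<longrightarrow>
    \<pi> (id + (\<Sum>s\<in>S. K_scale \<iota> (c s) s)) x = x"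
proof -
  have "openin (DK_topology vK \<iota>) {g \<in> carrier G. \<pi> g x = x}"
    using smooth unfolding smooth_representation_def by blast
  then obtain U where U: "openin (vs_topology vK (K_scale \<iota>) (carrier (DK_algebra \<iota>))) U"
    "{g \<in> carrier G. \<pi> g x = x} = U \<inter> carrier G"
    unfolding DK_topology_def openin_subtopology by blast
  have "id \<in> {g \<in> carrier G. \<pi> g x = x}" using G.one_closed by (simp add: \<pi>_id G_one)
  then have "id \<in> U" using U(2) by blast
  moreover have "S \<subseteq> carrier (DK_algebra \<iota>)" using S(2) by (simp add: DK_algebra_def)
  ultimately obtain n where n: "\<forall>c. (\<forall>s\<in>S. c s \<in> val_ball vK n) \<longrightarrow>
    id + (\<Sum>s\<in>S. K_scale \<iota> (c s) s) \<in> U"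
    using U(1) S(1) unfolding openin_vs_topology by blast
  show ?thesis
  proof (intro exI[of _ n] allI impI)
    fix c :: "('d \<Rightarrow> 'd) \<Rightarrow> 'k"
    assume "\<forall>s\<in>S. c s \<in> val_ball vK n" and G: "id + (\<Sum>s\<in>S. K_scale \<iota> (c s) s) \<in> carrier G"
    then have "id + (\<Sum>s\<in>S. K_scale \<iota> (c s) s) \<in> U" using n by blast
    then have "id + (\<Sum>s\<in>S. K_scale \<iota> (c s) s) \<in> {g \<in> carrier G. \<pi> g x = x}" using G U(2) by blast
    then show "\<pi> (id + (\<Sum>s\<in>S. K_scale \<iota> (c s) s)) x = x" by blast
  qed
qed

text \<open>Ramification doubles the valuation, which only helps when it is nonnegative; hence the
  bound \<open>max n 0\<close>.\<close>

lemma val_ball_j: assumes "a \<in> val_ball vF (max n 0)" shows "j a \<in> val_ball vK n"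
proof (cases "a = 0 \<or> j a = 0")
  case True
  have "\<iota> (j 0) = 0" by (simp add: \<iota>_j' i_hom)
  then have "j 0 = 0" by (simp add: \<iota>_hom)
  then show ?thesis using True by (auto simp: val_ball_def)
next
  case False
  then show ?thesis using assms vK_j[of a] by (simp add: val_ball_def)
qed

text \<open>The F-linear map E carries small F-combinations in D to small K-combinations of
  endomorphisms, because j maps small scalars to small scalars.\<close>

lemma stabilizer_neighbourhood_additive:
  fixes E :: "'d \<Rightarrow> 'd \<Rightarrow> 'd"
  assumes E: "\<And>a b. E (a + b) = E a + E b" "inj E" "\<And>a b. E (i a * b) = K_scale \<iota> (j a) (E b)"
    "\<And>b. E b \<in> carrier (End_ring \<Delta>)"
    and B: "finite B"
  shows "\<exists>n. \<forall>c. (\<forall>b\<in>B. c b \<in> val_ball vF n) \<longrightarrow> id + E (\<Sum>b\<in>B. i (c b) * b) \<in> carrier G \<longrightarrow>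
    \<pi> (id + E (\<Sum>b\<in>B. i (c b) * b)) x = x"
proof -
  have "finite (E ` B)" "E ` B \<subseteq> carrier (End_ring \<Delta>)" using B E(4) by auto
  from stabilizer_neighbourhood[OF this] obtain n where
    n: "\<And>c. (\<forall>s\<in>E ` B. c s \<in> val_ball vK n) \<Longrightarrow> id + (\<Sum>s\<in>E ` B. K_scale \<iota> (c s) s) \<in> carrier G \<Longrightarrow>
      \<pi> (id + (\<Sum>s\<in>E ` B. K_scale \<iota> (c s) s)) x = x" by blast
  have E0: "E 0 = 0" using E(1)[of 0 0] by simp
  have E_sum: "E (\<Sum>b\<in>B. f b) = (\<Sum>b\<in>B. E (f b))" for f
    using B by (induction B rule: finite_induct) (simp_all add: E0 E(1))
  show ?thesis
  proof (intro exI[of _ "max n 0"] allI impI)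
    fix c
    assume c: "\<forall>b\<in>B. c b \<in> val_ball vF (max n 0)" and G: "id + E (\<Sum>b\<in>B. i (c b) * b) \<in> carrier G"
    \<comment> \<open>The neighbourhood is indexed by E-images, so the coefficients are transported
      along the inverse of E; injectivity keeps distinct elements of B apart.\<close>
    define c' where "c' s = j (c (inv_into UNIV E s))" for s
    have c': "c' (E b) = j (c b)" for b using E(2) by (simp add: c'_def)
    have "(\<Sum>s\<in>E ` B. K_scale \<iota> (c' s) s) = (\<Sum>b\<in>B. K_scale \<iota> (c' (E b)) (E b))"
      using E(2) by (intro sum.reindex[unfolded o_def]) (auto intro: inj_on_subset)
    also have "\<dots> = E (\<Sum>b\<in>B. i (c b) * b)" by (simp add: E_sum E(3) c')
    finally have eq: "(\<Sum>s\<in>E ` B. K_scale \<iota> (c' s) s) = E (\<Sum>b\<in>B. i (c b) * b)" .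
    have "\<forall>s\<in>E ` B. c' s \<in> val_ball vK n" using c by (auto simp: c' val_ball_j)
    from n[of c', OF this] show "\<pi> (id + E (\<Sum>b\<in>B. i (c b) * b)) x = x"
      using G unfolding eq by blast
  qed
qed

text \<open>The map x to \<open>\<pi> (F x) u\<close> is locally constant: F(x + e) differs from
  F(x) by the left factor 1 + E(e x^-1), which fixes \<open>\<pi> (F x) u\<close> for small e.
  Compactness of the sphere then gives finiteness. The lemma serves \<open>lmul\<close> on D and
  \<open>diag\<close> on \<Delta>.\<close>

lemma finite_image_mod_scalars:
  fixes E F :: "'d \<Rightarrow> 'd \<Rightarrow> 'd"
  assumes X: "module.subspace (\<lambda>a x. i a * x) X"
    and E: "\<And>a b. E (a + b) = E a + E b" "inj E" "\<And>a b. E (i a * b) = K_scale \<iota> (j a) (E b)"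
    "\<And>b. E b \<in> carrier (End_ring \<Delta>)"
    and F: "\<And>x. x \<in> X - {0} \<Longrightarrow> F x \<in> carrier G"
    "\<And>x e. x \<in> X - {0} \<Longrightarrow> F (x + e) = (id + E (e * inverse x)) \<circ> F x"
    and \<omega>: "\<omega> \<noteq> 0" "vF \<omega> = 1"
  shows "\<exists>S\<subseteq>X - {0}. finite ((\<lambda>x. \<pi> (F x) u) ` S) \<and>
    (\<forall>x\<in>X - {0}. \<exists>k. \<exists>s\<in>S. x = i (power_int \<omega> k) * s)"
proof -
  interpret D: vector_space "\<lambda>a x. i a * x" by (rule vector_space_embedding[OF i])
  have lc: "\<exists>n. \<forall>c. (\<forall>b\<in>B. c b \<in> val_ball vF n) \<longrightarrow> x + (\<Sum>b\<in>B. i (c b) * b) \<noteq> 0 \<longrightarrow>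
      \<pi> (F (x + (\<Sum>b\<in>B. i (c b) * b))) u = \<pi> (F x) u"
    if x: "x \<in> X - {0}" and B: "finite B" "B \<subseteq> X" for x B
  proof -
    define E' where "E' b = E (b * inverse x)" for b
    have "inj E'"
    proof (rule injI)
      fix a b assume "E' a = E' b"
      then have "a * inverse x = b * inverse x" using E(2) unfolding E'_def by (auto dest: injD)
      then show "a = b" using x by simp
    qed
    then obtain n where n: "\<And>c. (\<forall>b\<in>B. c b \<in> val_ball vF n) \<Longrightarrow>
        id + E' (\<Sum>b\<in>B. i (c b) * b) \<in> carrier G \<Longrightarrow>
        \<pi> (id + E' (\<Sum>b\<in>B. i (c b) * b)) (\<pi> (F x) u) = \<pi> (F x) u"
      using stabilizer_neighbourhood_additive[of E' B "\<pi> (F x) u"] B(1) E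
      unfolding E'_def by (auto simp: distrib_right mult.assoc)
    show ?thesis
    proof (intro exI[of _ n] allI impI)
      fix c assume c: "\<forall>b\<in>B. c b \<in> val_ball vF n" and nz: "x + (\<Sum>b\<in>B. i (c b) * b) \<noteq> 0"
      define e where "e = (\<Sum>b\<in>B. i (c b) * b)"
      have "e \<in> X" unfolding e_def
        by (intro D.subspace_sum X) (use B(2) X in \<open>auto intro: D.subspace_scale\<close>)
      then have xe: "x + e \<in> X - {0}" using x X nz D.subspace_add unfolding e_def by blast
      have eq: "F (x + e) = (id + E' e) \<circ> F x" unfolding E'_def by (rule F(2)[OF x])
      have "id + E' e = F (x + e) \<circ> inv\<^bsub>G\<^esub> (F x)"
        unfolding eq comp_assoc G_inv(2)[OF F(1)[OF x]] by simp
      also have "\<dots> \<in> carrier G" using F(1) x xe by (intro G_comp G.inv_closed)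
      finally have G: "id + E' e \<in> carrier G" .
      have "\<pi> (F (x + e)) u = \<pi> (id + E' e) (\<pi> (F x) u)"
        unfolding eq by (rule \<pi>_comp[OF G F(1)[OF x]])
      also have "\<dots> = \<pi> (F x) u" using n[OF c] G unfolding e_def by blast
      finally show "\<pi> (F (x + (\<Sum>b\<in>B. i (c b) * b))) u = \<pi> (F x) u" unfolding e_def .
    qed
  qed
  obtain S where "S \<subseteq> X - {0}" "finite ((\<lambda>x. \<pi> (F x) u) ` S)"
    "\<And>x. x \<in> X - {0} \<Longrightarrow> \<exists>k. \<exists>s\<in>S. x = i (power_int \<omega> k) * s"
    by (rule finite_modulo_scalars[OF i finite_dim X \<omega> lc]) auto
  then show ?thesis by blast
qed

text \<open>Every nonzero h is a scalar \<open>i (power_int \<omega> k)\<close> times an element of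
  the sphere, and these scalars act trivially by assumption.\<close>

lemma finite_orbit_lmul:
  assumes "\<And>a x. a \<noteq> 0 \<Longrightarrow> \<pi> (lmul (i a)) x = x"
  shows "finite ((\<lambda>h. \<pi> (lmul h) u) ` (- {0}))"
proof -
  interpret D: vector_space "\<lambda>a x. i a * x" by (rule vector_space_embedding[OF i])
  obtain \<omega> where \<omega>: "\<omega> \<noteq> 0" "vF \<omega> = 1" using uniformizer by blast
  have add: "lmul (a + b) = lmul a + lmul b" for a b :: 'd
    by (simp add: lmul_def fun_eq_iff distrib_right)
  have inj: "inj (lmul :: 'd \<Rightarrow> 'd \<Rightarrow> 'd)"
  proof (rule injI)
    fix a b :: 'd assume "lmul a = lmul b"
    then have "lmul a 1 = lmul b 1" by simp
    then show "a = b" by (simp add: lmul_def)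
  qed
  have scale: "lmul (i a * b) = K_scale \<iota> (j a) (lmul b)" for a b
    by (simp add: lmul_def K_scale_def fun_eq_iff \<iota>_j' i_central mult.assoc)
  have comp: "lmul (x + e) = (id + lmul (e * inverse x)) \<circ> lmul x" if "x \<in> UNIV - {0}" for x e :: 'd
    using that by (simp add: lmul_def fun_eq_iff distrib_right flip: mult.assoc) (simp add: mult.assoc)
  have "\<exists>S\<subseteq>UNIV - {0}. finite ((\<lambda>x. \<pi> (lmul x) u) ` S) \<and>
    (\<forall>x\<in>UNIV - {0}. \<exists>k. \<exists>s\<in>S. x = i (power_int \<omega> k) * s)"
    by (rule finite_image_mod_scalars[OF D.subspace_UNIV add inj scale lmul_in_End _ comp \<omega>])
      (auto intro: lmul_G)
  then obtain S where S: "S \<subseteq> UNIV - {0}" "finite ((\<lambda>x. \<pi> (lmul x) u) ` S)"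
    "\<forall>x\<in>UNIV - {0}. \<exists>k. \<exists>s\<in>S. x = i (power_int \<omega> k) * s" by blast
  have "(\<lambda>h. \<pi> (lmul h) u) ` (- {0}) \<subseteq> (\<lambda>x. \<pi> (lmul x) u) ` S"
  proof (rule image_subsetI)
    fix h :: 'd assume "h \<in> - {0}"
    then obtain k s where s: "s \<in> S" "h = i (power_int \<omega> k) * s" using S(3) by blast
    have 0: "power_int \<omega> k \<noteq> 0" "i (power_int \<omega> k) \<noteq> 0" "s \<noteq> 0" using \<omega> s S(1) by (auto simp: i_hom)
    have "\<pi> (lmul h) u = \<pi> (lmul (i (power_int \<omega> k))) (\<pi> (lmul s) u)"
      unfolding s(2) lmul_mult using 0 by (intro \<pi>_comp lmul_G)
    also have "\<dots> = \<pi> (lmul s) u" using assms 0 by simp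
    finally show "\<pi> (lmul h) u \<in> (\<lambda>x. \<pi> (lmul x) u) ` S" using s(1) by simp
  qed
  then show ?thesis using S(2) by (rule finite_subset)
qed

text \<open>Write b = \<omega>^k s with s in the sphere of \<Delta>. Only finitely many vectors
  diag(1, s) u occur, and stability of W under diag(1, \<omega>) and its inverse supplies the powers
  of \<omega>.\<close>

lemma finitely_generated_diag:
  assumes \<omega>: "\<omega> \<noteq> 0" "vF \<omega> = 1"
  shows "\<exists>S. finite S \<and> (\<forall>W. V.subspace W \<longrightarrow> S \<subseteq> W \<longrightarrow>
      (\<forall>y\<in>W. \<pi> (diag (i \<omega>)) y \<in> W \<and> \<pi> (diag (inverse (i \<omega>))) y \<in> W) \<longrightarrow>
      (\<forall>b\<in>\<Delta> - {0}. \<pi> (diag b) u \<in> W))"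
proof -
  interpret D: vector_space "\<lambda>a x. i a * x" by (rule vector_space_embedding[OF i])
  have sub: "D.subspace \<Delta>"
    by (rule D.subspaceI) (auto intro: \<Delta>_0 \<Delta>_add \<Delta>_mult i_\<Delta>)
  \<comment> \<open>\<open>E b\<close> is the matrix diag(0, b), the part of \<open>diag b\<close>
    that is linear in b.\<close>
  define E where "E b = (\<lambda>y. w * (b * pr2 y))" for b
  have add: "E (a + b) = E a + E b" for a b
    by (simp add: E_def fun_eq_iff distrib_right distrib_left)
  have inj: "inj E"
  proof (rule injI)
    fix a b assume "E a = E b"
    then have "E a w = E b w" by simp
    then show "a = b" using pr_w(2)[OF \<Delta>_1] w0 by (simp add: E_def)
  qed
  have scale: "E (i a * b) = K_scale \<iota> (j a) (E b)" for a b
  proof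
    fix y
    have "w * (i a * (b * pr2 y)) = w * (b * pr2 y) * i a" by (simp add: i_central mult.assoc)
    then show "E (i a * b) y = K_scale \<iota> (j a) (E b) y" by (simp add: E_def K_scale_def \<iota>_j' mult.assoc)
  qed
  have End: "E b \<in> carrier (End_ring \<Delta>)" for b
    by (simp add: End_ring_def E_def pr_add pr_mult distrib_left mult.assoc)
  have comp: "diag (x + e) = (id + E (e * inverse x)) \<circ> diag x" if "x \<in> \<Delta> - {0}" for x e
  proof
    fix y
    have "e * inverse x * (x * pr2 y) = e * pr2 y"
      using that by (simp add: mult.assoc) (simp flip: mult.assoc)
    then show "diag (x + e) y = ((id + E (e * inverse x)) \<circ> diag x) y"
      using that by (simp add: E_def pr_diag) (simp add: diag_def distrib_left distrib_right add.assoc)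
  qed
  have "\<exists>S\<subseteq>\<Delta> - {0}. finite ((\<lambda>x. \<pi> (diag x) u) ` S) \<and>
    (\<forall>x\<in>\<Delta> - {0}. \<exists>k. \<exists>s\<in>S. x = i (power_int \<omega> k) * s)"
    by (rule finite_image_mod_scalars[OF sub add inj scale End diag_G comp \<omega>])
  then obtain S where S: "S \<subseteq> \<Delta> - {0}" "finite ((\<lambda>x. \<pi> (diag x) u) ` S)"
    "\<forall>x\<in>\<Delta> - {0}. \<exists>k. \<exists>s\<in>S. x = i (power_int \<omega> k) * s" by (elim exE conjE)
  have "\<pi> (diag b) u \<in> W"
    if W: "(\<lambda>x. \<pi> (diag x) u) ` S \<subseteq> W"
      "\<forall>y\<in>W. \<pi> (diag (i \<omega>)) y \<in> W \<and> \<pi> (diag (inverse (i \<omega>))) y \<in> W"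
      and b: "b \<in> \<Delta> - {0}" for W b
  proof -
    obtain k s where s: "s \<in> S" "b = i (power_int \<omega> k) * s" using S(3) b by blast
    have step: "\<pi> (diag (z ^ n * s)) u \<in> W"
      if z: "z \<in> \<Delta> - {0}" "\<And>y. y \<in> W \<Longrightarrow> \<pi> (diag z) y \<in> W" for z n
    proof (induction n)
      case 0
      then show ?case using W(1) s(1) by auto
    next
      case (Suc n)
      have zn: "z ^ n * s \<in> \<Delta> - {0}"
        using z(1) s(1) S(1) by (induction n) (auto simp: mult.assoc \<Delta>_mult)
      have "\<pi> (diag (z ^ Suc n * s)) u = \<pi> (diag z) (\<pi> (diag (z ^ n * s)) u)"
        using zn z(1) by (simp add: mult.assoc diag_mult \<pi>_comp diag_G)
      then show ?case using z(2)[OF Suc] by simp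
    qed
    have i\<omega>: "i \<omega> \<in> \<Delta> - {0}" "inverse (i \<omega>) \<in> \<Delta> - {0}"
      using \<omega> i_\<Delta> \<Delta>_inverse by (auto simp: i_hom)
    have i_pow: "i (x ^ n) = i x ^ n" for x n by (induction n) (simp_all add: i_hom)
    have i_inv: "i (inverse \<omega>) = inverse (i \<omega>)"
      using \<omega> i_hom(3)[of \<omega> "inverse \<omega>"] by (intro inverse_unique[symmetric]) (simp add: i_hom(1))
    have "b = i \<omega> ^ nat k * s \<or> b = inverse (i \<omega>) ^ nat (- k) * s"
      unfolding s(2) power_int_def by (auto simp only: i_pow i_inv split: if_split)
    moreover have "\<pi> (diag (i \<omega> ^ n * s)) u \<in> W" "\<pi> (diag (inverse (i \<omega>) ^ n * s)) u \<in> W" for n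
      using W(2) by (intro step i\<omega>; simp)+
    ultimately show ?thesis by auto
  qed
  then show ?thesis using S(2) by blast
qed

end

context DK_representation
begin

subsection \<open>The Jacquet module\<close>

lemma unipotent_radical_conj:
  assumes g: "g \<in> carrier G" "g ` L = L'" and n: "n \<in> unipotent_radical \<iota> L"
  shows "g \<circ> n \<circ> inv\<^bsub>G\<^esub> g \<in> unipotent_radical \<iota> L'"
proof -
  have n': "n \<in> carrier G" "\<And>y. y \<in> L \<Longrightarrow> n y = y" "\<And>y. n y - y \<in> L"
    using n unfolding unipotent_radical_def by auto
  have "(g \<circ> n \<circ> inv\<^bsub>G\<^esub> g) y = y" if y: "y \<in> L'" for y
  proof -
    obtain x where "x \<in> L" "y = g x" using y g(2) by blast
    then show ?thesis using n'(2) by (simp add: G_inv_apply[OF g(1)])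
  qed
  moreover have "(g \<circ> n \<circ> inv\<^bsub>G\<^esub> g) y - y \<in> L'" for y
  proof -
    have "(g \<circ> n \<circ> inv\<^bsub>G\<^esub> g) y - y = g (n ((inv\<^bsub>G\<^esub> g) y)) - g ((inv\<^bsub>G\<^esub> g) y)"
      by (simp add: G_inv_apply[OF g(1)])
    also have "\<dots> = g (n ((inv\<^bsub>G\<^esub> g) y) - (inv\<^bsub>G\<^esub> g) y)" by (rule G_linear(2)[OF g(1), symmetric])
    also have "\<dots> \<in> L'" using n'(3) g(2) by blast
    finally show ?thesis .
  qed
  moreover have "g \<circ> n \<circ> inv\<^bsub>G\<^esub> g \<in> carrier G" using g(1) n'(1) by (intro G_comp G.inv_closed)
  ultimately show ?thesis unfolding unipotent_radical_def by blast
qed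

text \<open>Conjugation turns generators into generators: \<pi> g (\<pi> n x - x) is \<pi>(g n g^-1)
  y - y with y = \<pi> g x.\<close>

lemma jacquet_kernel_image:
  assumes g: "g \<in> carrier G" "g ` L = L'" and x: "x \<in> jacquet_kernel (unipotent_radical \<iota> L) sV \<pi>"
  shows "\<pi> g x \<in> jacquet_kernel (unipotent_radical \<iota> L') sV \<pi>"
  using x unfolding jacquet_kernel_def
proof (induction rule: V.span_induct_alt)
  case base
  then show ?case by (simp add: \<pi>_hom[OF g(1)] V.span_zero)
next
  case (step c t y)
  then obtain n x where t: "t = \<pi> n x - x" "n \<in> unipotent_radical \<iota> L" by blast
  then have n: "n \<in> carrier G" by (simp add: unipotent_radical_def)
  have gng: "g \<circ> n \<circ> inv\<^bsub>G\<^esub> g \<in> unipotent_radical \<iota> L'" by (rule unipotent_radical_conj[OF g t(2)])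
  have "\<pi> (g \<circ> n \<circ> inv\<^bsub>G\<^esub> g) (\<pi> g x) = \<pi> (g \<circ> n) (\<pi> (inv\<^bsub>G\<^esub> g) (\<pi> g x))"
    using g(1) n by (intro \<pi>_comp G_comp G.inv_closed)
  also have "\<dots> = \<pi> g (\<pi> n x)" by (simp add: \<pi>_inv[OF g(1)] \<pi>_comp[OF g(1) n])
  finally have "\<pi> g t = \<pi> (g \<circ> n \<circ> inv\<^bsub>G\<^esub> g) (\<pi> g x) - \<pi> g x"
    by (simp add: t(1) \<pi>_hom[OF g(1)])
  then have "\<pi> g t \<in> {\<pi> n x - x |n x. n \<in> unipotent_radical \<iota> L'}" using gng by blast
  then show ?case
    using step(2) by (simp add: \<pi>_hom[OF g(1)]) (blast intro: V.span_add V.span_scale V.span_base)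
qed

definition U0 :: "'v set" where "U0 = jacquet_kernel (unipotent_radical \<iota> \<Delta>) sV \<pi>"

text \<open>Every line is y \<Delta>, the image of \<Delta> under left multiplication by y. So if
  the Jacquet module vanished for \<Delta>, it would vanish for all lines, and \<pi> would be
  cuspidal.\<close>

lemma U0_proper: "U0 \<noteq> UNIV"
proof
  assume U0: "U0 = UNIV"
  have "jacquet_kernel (unipotent_radical \<iota> L) sV \<pi> = UNIV" if L: "is_line \<Delta> L" for L
  proof -
    obtain y where y: "y \<noteq> 0" "L = {y * c | c. c \<in> \<Delta>}" using L unfolding is_line_def by blast
    have g: "lmul y \<in> carrier G" "lmul y ` \<Delta> = L" using y lmul_G by (auto simp: lmul_def)
    have "x \<in> jacquet_kernel (unipotent_radical \<iota> L) sV \<pi>" for x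
    proof -
      have "\<pi> (inv\<^bsub>G\<^esub> (lmul y)) x \<in> U0" using U0 by simp
      from jacquet_kernel_image[OF g this[unfolded U0_def]] show ?thesis by (simp add: \<pi>_inv[OF g(1)])
    qed
    then show ?thesis by blast
  qed
  then show False using not_cuspidal unfolding cuspidal_def by blast
qed

lemma U0_diag: assumes "b \<in> \<Delta> - {0}" "x \<in> U0" shows "\<pi> (diag b) x \<in> U0"
proof -
  have "diag b ` \<Delta> = \<Delta>" by (auto simp: diag_\<Delta> image_iff)
  then show ?thesis using jacquet_kernel_image[OF diag_G[OF assms(1)]] assms(2) unfolding U0_def by blast
qed

lemma U0_lmul: assumes "s \<in> \<Delta> - {0}" "x \<in> U0" shows "\<pi> (lmul s) x \<in> U0"
proof -
  have s: "s \<noteq> 0" "s \<in> \<Delta>" using assms by auto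
  have "y \<in> lmul s ` \<Delta>" if "y \<in> \<Delta>" for y
    by (rule image_eqI[of _ _ "inverse s * y"])
      (use s that in \<open>auto simp: lmul_def intro: \<Delta>_mult \<Delta>_inverse simp flip: mult.assoc\<close>)
  then have "lmul s ` \<Delta> = \<Delta>" using s by (auto simp: lmul_def intro: \<Delta>_mult)
  then show ?thesis using jacquet_kernel_image[OF lmul_G[OF s(1)]] assms(2) unfolding U0_def by blast
qed

text \<open>\<open>D\<^sup>\<times>\<close> acts transitively on the lines, so \<open>G = N \<cdot> diag(1, \<Delta>\<^sup>\<times>) \<cdot> D\<^sup>\<times>\<close>.\<close>

lemma group_decomposition:
  assumes g: "g \<in> carrier G"
  shows "\<exists>n b h. n \<in> unipotent_radical \<iota> \<Delta> \<and> b \<in> \<Delta> - {0} \<and> h \<noteq> 0 \<and> g = n \<circ> (diag b \<circ> lmul h)"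
proof -
  \<comment> \<open>Left multiplication by the preimage y of 1 corrects g to an element p that fixes
    1; splitting off diag(1, b) from p leaves a unipotent n.\<close>
  define y where "y = (inv\<^bsub>G\<^esub> g) 1"
  have gy: "g y = 1" unfolding y_def by (rule G_inv_apply(2)[OF g])
  have y: "y \<noteq> 0" using gy G_linear(2)[OF g, of 0 0] by auto
  define p where "p = g \<circ> lmul y"
  have p: "p \<in> carrier G" unfolding p_def using g y by (intro G_comp lmul_G)
  have "inj p" using G_inv_apply(1)[OF p] by (metis injI)
  moreover have "p 1 = 1" unfolding p_def using gy by (simp add: lmul_def)
  ultimately obtain b where b: "b \<in> \<Delta> - {0}" "\<And>y. y \<in> \<Delta> \<Longrightarrow> p (diag (inverse b) y) = y"
    "\<And>y. p (diag (inverse b) y) - y \<in> \<Delta>"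
    using fixes_1_decomposition[of p] p mem_G by metis
  have ib: "inverse b \<in> \<Delta> - {0}" using b(1) \<Delta>_inverse by auto
  define n where "n = p \<circ> diag (inverse b)"
  have "n \<in> unipotent_radical \<iota> \<Delta>"
    unfolding unipotent_radical_def n_def using b(2,3) p diag_G[OF ib] G_comp by auto
  moreover have "g = n \<circ> (diag b \<circ> lmul (inverse y))"
  proof -
    have d: "diag (inverse b) \<circ> diag b = id" using b(1) by (simp flip: diag_mult add: diag_1)
    have l: "lmul y \<circ> lmul (inverse y) = id" using y by (simp flip: lmul_mult) (simp add: lmul_def fun_eq_iff)
    have "n \<circ> (diag b \<circ> lmul (inverse y)) = p \<circ> (diag (inverse b) \<circ> diag b) \<circ> lmul (inverse y)"
      by (simp add: n_def comp_assoc)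
    also have "\<dots> = g" by (simp add: d p_def comp_assoc l)
    finally show ?thesis ..
  qed
  ultimately show ?thesis using b(1) y by (intro exI[of _ n] exI[of _ b] exI[of _ "inverse y"]) simp
qed

text \<open>The vectors whose G-orbit lies in U form a subrepresentation. It contains v: in g = n
  diag(1, b) h the factor h fixes v, diag(1, b) preserves U, and n changes a vector only by an
  element of V(N).\<close>

lemma fixed_vector_generates:
  assumes v: "v \<noteq> 0" "\<And>h. h \<noteq> 0 \<Longrightarrow> \<pi> (lmul h) v = v"
    and U: "V.subspace U" "U0 \<subseteq> U" "\<And>b x. b \<in> \<Delta> - {0} \<Longrightarrow> x \<in> U \<Longrightarrow> \<pi> (diag b) x \<in> U" "v \<in> U"
  shows "U = UNIV"
proof -
  define W where "W = {x. \<forall>g\<in>carrier G. \<pi> g x \<in> U}"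
  have "V.subspace W"
    unfolding W_def
    by (rule V.subspaceI) (use U(1) in \<open>auto simp: \<pi>_hom V.subspace_0 V.subspace_add V.subspace_scale\<close>)
  moreover have "\<pi> g ` W \<subseteq> W" if "g \<in> carrier G" for g
  proof (rule image_subsetI)
    fix x assume "x \<in> W"
    then have "\<pi> (h \<circ> g) x \<in> U" if "h \<in> carrier G" for h
      using that \<open>g \<in> carrier G\<close> G_comp unfolding W_def by blast
    then show "\<pi> g x \<in> W" unfolding W_def using \<open>g \<in> carrier G\<close> by (simp add: \<pi>_comp)
  qed
  ultimately have "W = {0} \<or> W = UNIV"
    using irreducible unfolding irreducible_representation_def by blast
  moreover have "v \<in> W"
    unfolding W_def
  proof (intro CollectI ballI)
    fix g assume "g \<in> carrier G"
    then obtain n b h where nbh: "n \<in> unipotent_radical \<iota> \<Delta>" "b \<in> \<Delta> - {0}" "h \<noteq> 0"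
      "g = n \<circ> (diag b \<circ> lmul h)" using group_decomposition by blast
    have n: "n \<in> carrier G" using nbh(1) by (simp add: unipotent_radical_def)
    define u where "u = \<pi> (diag b) v"
    have u: "u \<in> U" unfolding u_def by (intro U nbh)
    have "\<pi> g v = \<pi> n (\<pi> (diag b) (\<pi> (lmul h) v))"
      using nbh n by (simp add: \<pi>_comp G_comp diag_G lmul_G)
    also have "\<dots> = (\<pi> n u - u) + u" using v(2)[OF nbh(3)] by (simp add: u_def)
    also have "\<dots> \<in> U"
    proof (rule V.subspace_add[OF U(1) _ u])
      have "\<pi> n u - u \<in> U0" unfolding U0_def jacquet_kernel_def using nbh(1) by (blast intro: V.span_base)
      then show "\<pi> n u - u \<in> U" using U(2) by blast
    qed
    finally show "\<pi> g v \<in> U" .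
  qed
  ultimately have W: "W = UNIV" using v(1) by blast
  have "x \<in> U" for x
  proof -
    have "x \<in> W" using W by simp
    then have "\<pi> id x \<in> U" unfolding W_def using G.one_closed G_one by simp
    then show ?thesis by (simp add: \<pi>_id)
  qed
  then show ?thesis by blast
qed

section \<open>Fixed vectors and invariant forms\<close>

lemma lmul_fixed_vector_unique:
  assumes trivial: "\<And>a x. a \<noteq> 0 \<Longrightarrow> \<pi> (lmul (i a)) x = x"
    and v: "v \<noteq> 0" "\<And>h. h \<noteq> 0 \<Longrightarrow> \<pi> (lmul h) v = v" and v': "\<And>h. h \<noteq> 0 \<Longrightarrow> \<pi> (lmul h) v' = v'"
  shows "\<exists>c. v' = sV c v"
proof -
  obtain \<omega> where \<omega>: "\<omega> \<noteq> 0" "vF \<omega> = 1" using uniformizer by blast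
  interpret F: fixed_vector_setting sV \<Delta> "\<lambda>h. \<pi> (lmul h)" "\<lambda>b. \<pi> (diag b)" \<theta> "i \<omega>" U0
  proof (rule fixed_vector_setting.intro[OF V.vector_space_axioms], rule fixed_vector_setting_axioms.intro)
    show "a * b \<in> \<Delta>" if "a \<in> \<Delta>" "b \<in> \<Delta>" for a b using that by (rule \<Delta>_mult)
    show "inverse a \<in> \<Delta>" if "a \<in> \<Delta>" for a using that by (rule \<Delta>_inverse)
    show "1 \<in> \<Delta>" by (rule \<Delta>_1)
    show "Vector_Spaces.linear sV sV (\<pi> (lmul h))" if "h \<noteq> 0" for h
      using that by (intro \<pi>_linear lmul_G)
    show "\<pi> (lmul (g * h)) x = \<pi> (lmul g) (\<pi> (lmul h) x)" if "g \<noteq> 0" "h \<noteq> 0" for g h x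
      unfolding lmul_mult using that by (intro \<pi>_comp lmul_G)
    have "lmul 1 = (id :: 'd \<Rightarrow> 'd)" by (simp add: lmul_def fun_eq_iff)
    then show "\<pi> (lmul 1) x = x" for x by (simp add: \<pi>_id)
    show "Vector_Spaces.linear sV sV (\<pi> (diag b))" if "b \<in> \<Delta> - {0}" for b
      using that by (intro \<pi>_linear diag_G)
    show "\<pi> (diag (b * c)) x = \<pi> (diag b) (\<pi> (diag c) x)" if "b \<in> \<Delta> - {0}" "c \<in> \<Delta> - {0}" for b c x
      using that by (simp add: diag_mult \<pi>_comp diag_G)
    show "\<pi> (diag 1) x = x" for x by (simp add: diag_1 \<pi>_id)
    show "\<theta> s \<in> \<Delta> - {0}" if "s \<in> \<Delta> - {0}" for s
      using that \<theta>_closed(1)[of s] w0 by (simp add: \<theta>_def)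
    show "\<theta> (s * t) = \<theta> s * \<theta> t" for s t
    proof -
      have "\<theta> s * \<theta> t = inverse w * s * (w * inverse w) * t * w" by (simp only: \<theta>_def mult.assoc)
      also have "\<dots> = \<theta> (s * t)" unfolding right_inverse[OF w0] by (simp add: \<theta>_def mult.assoc)
      finally show ?thesis ..
    qed
    show "\<theta> (inverse s) = inverse (\<theta> s)" for s
    proof (cases "s = 0")
      case False
      then show ?thesis using w0 by (simp add: \<theta>_def nonzero_inverse_mult_distrib mult.assoc)
    qed (simp add: \<theta>_def)
    show "\<exists>s\<in>\<Delta> - {0}. \<theta> s = b" if "b \<in> \<Delta> - {0}" for b
    proof (rule bexI[of _ "w * b * inverse w"])
      have "inverse w * (w * b * inverse w) * w = (inverse w * w) * b * (inverse w * w)"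
        by (simp only: mult.assoc)
      then show "\<theta> (w * b * inverse w) = b" using w0 by (simp add: \<theta>_def)
      show "w * b * inverse w \<in> \<Delta> - {0}" using that \<theta>_closed(2)[of b] w0 by simp
    qed
    show "\<pi> (lmul s) (\<pi> (diag b) x) = \<pi> (diag (\<theta> s * b * inverse (\<theta> s))) (\<pi> (lmul s) x)"
      if "s \<in> \<Delta> - {0}" "b \<in> \<Delta> - {0}" for s b x
    proof -
      have ts: "\<theta> s \<in> \<Delta>" "\<theta> s \<noteq> 0" using that(1) \<theta>_closed(1)[of s] w0 by (simp_all add: \<theta>_def)
      then have c: "\<theta> s * b * inverse (\<theta> s) \<in> \<Delta> - {0}" using that(2) by (simp add: \<Delta>_mult \<Delta>_inverse)
      have s: "lmul s \<in> carrier G" using that(1) by (simp add: lmul_G)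
      have "\<pi> (lmul s) (\<pi> (diag b) x) = \<pi> (lmul s \<circ> diag b) x"
        by (rule \<pi>_comp[OF s diag_G[OF that(2)], symmetric])
      also have "lmul s \<circ> diag b = diag (\<theta> s * b * inverse (\<theta> s)) \<circ> lmul s"
        using that by (intro lmul_diag) simp_all
      also have "\<pi> \<dots> x = \<pi> (diag (\<theta> s * b * inverse (\<theta> s))) (\<pi> (lmul s) x)"
        by (rule \<pi>_comp[OF diag_G[OF c] s])
      finally show ?thesis .
    qed
    show "V.subspace U0" unfolding U0_def jacquet_kernel_def by (rule V.subspace_span)
    show "U0 \<noteq> UNIV" by (rule U0_proper)
    show "\<pi> (diag b) x \<in> U0" if "b \<in> \<Delta> - {0}" "x \<in> U0" for b x using that by (rule U0_diag)
    show "\<pi> (lmul s) x \<in> U0" if "s \<in> \<Delta> - {0}" "x \<in> U0" for s x using that by (rule U0_lmul)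
    show "U = UNIV" if "v \<noteq> 0" "\<And>h. h \<noteq> 0 \<Longrightarrow> \<pi> (lmul h) v = v" "V.subspace U" "U0 \<subseteq> U"
      "\<And>b x. b \<in> \<Delta> - {0} \<Longrightarrow> x \<in> U \<Longrightarrow> \<pi> (diag b) x \<in> U" "v \<in> U" for v U
      by (rule fixed_vector_generates[OF that])
    show "finite ((\<lambda>h. \<pi> (lmul h) x) ` (- {0}))" for x by (rule finite_orbit_lmul[OF trivial])
    show "i \<omega> \<in> \<Delta> - {0}" using i_\<Delta> \<omega> by (simp add: i_hom)
    show "i \<omega> * b = b * i \<omega>" for b by (rule i_central)
    show "\<exists>S. finite S \<and> (\<forall>W. V.subspace W \<longrightarrow> S \<subseteq> W \<longrightarrow>
        (\<forall>y\<in>W. \<pi> (diag (i \<omega>)) y \<in> W \<and> \<pi> (diag (inverse (i \<omega>))) y \<in> W) \<longrightarrow>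
        (\<forall>b\<in>\<Delta> - {0}. \<pi> (diag b) x \<in> W))" for x
      by (rule finitely_generated_diag[OF \<omega>])
  qed
  show ?thesis by (rule F.fixed_vector_unique[OF v v'])
qed

text \<open>The witness is the average of the finite orbit of x. Each h permutes the orbit, and an
  invariant form is constant on it.\<close>

lemma average_over_orbit:
  assumes trivial: "\<And>a x. a \<noteq> 0 \<Longrightarrow> \<pi> (lmul (i a)) x = x"
  obtains e where "\<And>h. h \<noteq> 0 \<Longrightarrow> \<pi> (lmul h) e = e"
    "\<And>l. l \<in> hom_to_trivial D_units sV \<pi> \<Longrightarrow> l e = l x"
proof -
  define O' where "O' = (\<lambda>h. \<pi> (lmul h) x) ` (- {0})"
  have fin: "finite O'" unfolding O'_def by (rule finite_orbit_lmul[OF trivial])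
  have "\<pi> (lmul 1) x \<in> O'" unfolding O'_def by (rule imageI) simp
  then have n: "of_nat (card O') \<noteq> (0::complex)" using fin by (auto simp: card_eq_0_iff)
  define e where "e = sV (inverse (of_nat (card O'))) (\<Sum>y\<in>O'. y)"
  show thesis
  proof (rule that)
    fix h :: 'd assume h: "h \<noteq> 0"
    have "\<pi> (lmul h) ` O' \<subseteq> O'"
    proof (rule image_subsetI)
      fix y assume "y \<in> O'"
      then obtain g where g: "g \<noteq> 0" "y = \<pi> (lmul g) x" unfolding O'_def by blast
      then have "\<pi> (lmul h) y = \<pi> (lmul (h * g)) x"
        using h by (simp add: lmul_mult \<pi>_comp lmul_G)
      moreover have "h * g \<in> - {0}" using h g by simp
      ultimately show "\<pi> (lmul h) y \<in> O'" unfolding O'_def by blast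
    qed
    moreover have inj: "inj_on (\<pi> (lmul h)) O'"
      by (rule inj_on_inverseI[of _ "\<pi> (inv\<^bsub>G\<^esub> (lmul h))"]) (rule \<pi>_inv(1)[OF lmul_G[OF h]])
    ultimately have "\<pi> (lmul h) ` O' = O'" using fin by (simp add: endo_inj_surj)
    then have "(\<Sum>y\<in>O'. \<pi> (lmul h) y) = (\<Sum>y\<in>O'. y)" using sum.reindex[OF inj, of "\<lambda>y. y"] by simp
    then show "\<pi> (lmul h) e = e" by (simp add: e_def \<pi>_hom[OF lmul_G[OF h]])
  next
    fix l assume l: "l \<in> hom_to_trivial D_units sV \<pi>"
    then interpret l: Vector_Spaces.linear sV "(*)" l by (simp add: hom_to_trivial_def)
    have "l y = l x" if "y \<in> O'" for y
      using that l unfolding O'_def hom_to_trivial_def D_units_def by auto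
    then show "l e = l x" using n by (simp add: e_def l.scale l.sum)
  qed
qed

text \<open>By averaging, invariant forms are determined by their values on fixed vectors, which are
  multiples of one v. So all are proportional to an \<open>l0\<close> with \<open>l0 v\<close>
  nonzero. Inclusion in the span of one form also settles finite-dimensionality.\<close>

theorem hom_to_trivial_dim:
  assumes central: "unitary_central_character G sV \<pi>"
  shows "form_dim_le (hom_to_trivial D_units sV \<pi>) 1"
proof -
  interpret forms: vector_space form_scale by (rule vector_space_form_scale)
  let ?H = "hom_to_trivial D_units sV \<pi>"
  have "\<exists>l0. ?H \<subseteq> forms.span {l0}"
  proof (cases "?H \<subseteq> {0}")
    case True
    then have "?H \<subseteq> forms.span {0}" using forms.span_superset by blast
    then show ?thesis by blast
  next
    case False
    then obtain l0 where "l0 \<in> ?H" "l0 \<noteq> 0" by blast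
    then obtain x where l0: "l0 \<in> ?H" "l0 x \<noteq> 0" by (auto simp: fun_eq_iff)
    \<comment> \<open>Scalars from F act through the central character; evaluating the invariant
      form \<open>l0\<close> at x, where it does not vanish, shows that this character is 1 on
      them.\<close>
    have trivial: "\<pi> (lmul (i a)) y = y" if a: "a \<noteq> 0" for a y
    proof -
      have ia: "i a \<noteq> 0" using a by (simp add: i_hom)
      have "lmul (i a) \<in> group_center G"
        unfolding group_center_def G_mult
        using lmul_G[OF ia] G_linear(3)[OF _ i_\<Delta>]
        by (auto simp: lmul_def fun_eq_iff i_central)
      then obtain c where c: "\<And>y. \<pi> (lmul (i a)) y = sV c y"
        using central unfolding unitary_central_character_def by blast
      interpret l: Vector_Spaces.linear sV "(*)" l0 using l0(1) by (simp add: hom_to_trivial_def)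
      have "l0 (\<pi> (lmul (i a)) x) = l0 x"
        using l0(1) ia unfolding hom_to_trivial_def D_units_def by blast
      then have "c = 1" using l0(2) by (simp add: c l.scale)
      then show ?thesis by (simp add: c)
    qed
    obtain v where v: "\<And>h. h \<noteq> 0 \<Longrightarrow> \<pi> (lmul h) v = v" "\<And>l. l \<in> ?H \<Longrightarrow> l v = l x"
      by (rule average_over_orbit[OF trivial, of x]) auto
    interpret l0: Vector_Spaces.linear sV "(*)" l0 using l0(1) by (simp add: hom_to_trivial_def)
    have v0: "v \<noteq> 0" using v(2)[OF l0(1)] l0(2) l0.zero by auto
    \<comment> \<open>Both l and \<open>l0\<close> depend on y only through the coefficient c of its
      average \<open>e = sV c v\<close>, so their ratio is the one at v.\<close>
    have "l = form_scale (l v / l0 v) l0" if l: "l \<in> ?H" for l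
    proof
      fix y
      interpret l: Vector_Spaces.linear sV "(*)" l using l by (simp add: hom_to_trivial_def)
      obtain e where e: "\<And>h. h \<noteq> 0 \<Longrightarrow> \<pi> (lmul h) e = e" "\<And>l. l \<in> ?H \<Longrightarrow> l e = l y"
        by (rule average_over_orbit[OF trivial, of y]) auto
      obtain c where "e = sV c v"
        using lmul_fixed_vector_unique[OF trivial v0 v(1) e(1)] by blast
      then have "l y = c * l v" "l0 y = c * l0 v"
        using e(2)[OF l] e(2)[OF l0(1)] by (simp_all add: l.scale l0.scale)
      then show "l y = form_scale (l v / l0 v) l0 y"
        using v(2)[OF l0(1)] l0(2) by (simp add: form_scale_def)
    qed
    then have "?H \<subseteq> forms.span {l0}"
      unfolding forms.span_singleton by blast
    then show ?thesis by blast
  qed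
  then obtain l0 where l0: "?H \<subseteq> forms.span {l0}" by blast
  then have "forms.dim ?H \<le> card {l0}" by (rule forms.dim_le_card) simp
  then show ?thesis unfolding form_dim_le_def using l0 by auto
qed

end


theorem mainTheorem1:
  fixes vF :: "'f::field \<Rightarrow> int"
    and vK :: "'k::field \<Rightarrow> int"
    and j :: "'f \<Rightarrow> 'k"
    and i :: "'f \<Rightarrow> 'd::division_ring"
    and \<iota> :: "'k \<Rightarrow> 'd"
    and d :: nat
    and sV :: "complex \<Rightarrow> 'v::ab_group_add \<Rightarrow> 'v"
    and \<pi> :: "('d \<Rightarrow> 'd) \<Rightarrow> 'v \<Rightarrow> 'v"
  assumes "nonarch_local_field vF" and "nonarch_local_field vK"
    and "quadratic_extension j"
    and "separable_extension j"
    and "totally_ramified j vF vK"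
    and "tamely_ramified j vF vK"
    and "central_division_algebra i d" and "even d"
    and "ring_embedding \<iota>" and "\<iota> \<circ> j = i"
    and "smooth_representation (DK_group \<iota>) (DK_topology vK \<iota>) sV \<pi>"
    and "irreducible_representation (DK_group \<iota>) sV \<pi>"
    and "discrete_series (DK_group \<iota>) (DK_topology vK \<iota>) sV \<pi>"
    and "level_zero vK \<iota> \<pi>"
    and "\<not> cuspidal \<iota> sV \<pi>"
  shows "form_dim_le (hom_to_trivial D_units sV \<pi>) 1"
proof -
  have two: "(2::'f) \<noteq> 0"
    using assms(1,3,5,6) by (intro tame_two_nonzero[of vF j vK]) (simp_all add: quadratic_extension_def)
  have i: "ring_embedding i" "range i = {z. \<forall>x. z * x = x * z}" "dim_over i > 0"
    using assms(7) by (simp_all add: central_division_algebra_def)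
  obtain \<kappa> w where "anticommuting_pair \<kappa> w (centralizer (range \<iota>))"
    by (rule exists_anticommuting_pair[OF assms(3) two i(1,2) assms(9,10)])
  \<comment> \<open>The ramification index of a totally ramified extension is its degree, here
    2.\<close>
  moreover have "vK (j a) = 2 * vF a" if "a \<noteq> 0" for a
    using assms(3,5) that
    by (simp add: quadratic_extension_def totally_ramified_def has_ramification_index_def)
  ultimately interpret DK_representation \<kappa> w \<iota> vF vK j i sV \<pi>
    using assms i
    by (intro DK_representation.intro DK_representation_axioms.intro local_field.intro) simp_all
  show ?thesis
    using assms(13) by (intro hom_to_trivial_dim) (simp add: discrete_series_def)
qed

end
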